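(* Let $X$ be a compact space and let $P$ be a directed set which is not countably directed. Then the following are equivalent: (1) $X$ embeds in $C_p(S(\mathcal F))$ for some infinite set $S$ and free filter $\mathcal F$ on $S$ such that $S(\mathcal F)$ has a $P$-ordered compact cover; (2) $X$ has a $P$-point finite almost subbase; (3) $X$ has a $P$-point additively Noetherian base; (4) $X$ has a $P$-point additively Noetherian expandable network; (5) $X$ has a $P$-additively Noetherian strong point network; (6) $X$ has a $P$-additively Noetherian point network.
   Context: All spaces are Tychonoff (completely regular Hausdorff). $\mathbb N=\{1,2,\dots\}$. A directed set is a partially ordered set in which any two elements have an upper bound; it is countably directed if every countable subset has an upper bound. Filter spaces. For an infinite set $S$ and a free filter $\mathcal F$ on $S$ (the possibility that $\mathcal F$ is the whole power set of $S$ is allowed), $S(\mathcal F)$ is the space with underlying set $S\cup\{\ast\}$ ($\ast\notin S$) in which points of $S$ are isolated and neighborhoods of $\ast$ are the sets $\{\ast\}\cup U$, $U\in\mathcal F$. $C_p(Z)$ is the set of continuous functions $Z\to\mathbb R$ as a subspace of $\mathbb R^Z$. A $P$-ordered compact cover of a space $Z$ is a cover $\{C_p:p\in P\}$ by compact sets with $C_p\subseteq C_{p'}$ whenever $p\le p'$. $P$-ordering. A collection $\mathcal C$ is $P$-ordered as $\mathcal C=\bigcup_{p\in P}\mathcal C_p$ if $p\le p'$ implies $\mathcal C_p\subseteq\mathcal C_{p'}$. For a property $\mathcal Q$ of collections, $\mathcal C$ is $P$-$\mathcal Q$ if it can be $P$-ordered so that every $\mathcal C_p$ has $\mathcal Q$.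 For a collection $\mathcal C$ of subsets of $X$ and $x\in X$, $(\mathcal C)_x=\{C\in\mathcal C:x\in C\}$; for a collection $\mathcal C$ of pairs of subsets, $(\mathcal C)_x=\{(C_1,C_2)\in\mathcal C:x\in C_2\}$. $\mathcal C$ is point finite if every $(\mathcal C)_x$ is finite, and point additively Noetherian if every $(\mathcal C)_x$ is additively Noetherian. Noetherian. A family of sets is Noetherian if every subfamily well-ordered by $\subseteq$ is finite; it is additively Noetherian if the collection of all unions of its members is Noetherian. For a family of pairs $(N,V)$, additively Noetherian refers to the family of first coordinates $N$. Almost subbase. A (co)zero set of $X$ is the (co)zero set of some continuous $f:X\to[0,1]$. A $U$-representation of $V\subseteq X$ is a sequence $U(V)=\{U_n(V):n\in\mathbb N\}$ with $V=\bigcup_n U_n(V)$, $U_n(V)\subseteq U_{n+1}(V)$, $U_{2n-1}(V)$ a zero set and $U_{2n}(V)$ a cozero set for all $n$. A family $\alpha$ of subsets of $X$ is an almost subbase if one can choose $U$-representations $U(V)$, $V\in\alpha$, such that $\alpha\cup\{X\setminus U_{2n-1}(V):V\in\alpha,n\in\mathbb N\}$ is a subbase of $X$. Expandable network. A collection $\mathcal N$ of pairs $(N,V)$ of subsets of $X$ with $N\subseteq V$ and $V$ open, such that whenever $x\in U$, $U$ open, there is $(N,V)\in\mathcal N$ with $x\in N\subseteq U$. Point networks. A $P$-$\mathcal Q$ point network (respectively strong point network) for $X$ is $\mathcal W=\{\mathcal W(x):x\in X\}$, where each $\mathcal W(x)=\bigcup_{p\in P}\mathcal W_p(x)$ is a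 collection of subsets of $X$ containing $x$, each $\mathcal W_p(x)$ has $\mathcal Q$, $p\le p'$ implies $\mathcal W_p(x)\subseteq\mathcal W_{p'}(x)$, and whenever a point $x$ is in an open set $U$ there are an open $V$ with $x\in V\subseteq U$ and a $p\in P$ such that for every $y\in V$ there is $W\in\mathcal W_p(y)$ with $x\in W\subseteq U$ (respectively $x\in W\subseteq V$). *)

theory Defs
  imports "HOL-Analysis.Analysis"
begin

section \<open>Directed sets\<close>

text \<open>Directed sets are required to be nonempty, as usual; they are partially ordered by an
  explicit relation \<open>r\<close> on the carrier \<open>P\<close>, where \<open>(p, q) \<in> r\<close> means \<open>p \<le> q\<close>.\<close>

definition directed_set :: "'p set \<Rightarrow> 'p rel \<Rightarrow> bool" where
  "directed_set P r \<longleftrightarrow> partial_order_on P r \<and> P \<noteq> {} \<and>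
     (\<forall>p\<in>P. \<forall>q\<in>P. \<exists>u\<in>P. (p, u) \<in> r \<and> (q, u) \<in> r)"

definition countably_directed :: "'p set \<Rightarrow> 'p rel \<Rightarrow> bool" where
  "countably_directed P r \<longleftrightarrow>
     (\<forall>A. A \<subseteq> P \<and> countable A \<longrightarrow> (\<exists>u\<in>P. \<forall>a\<in>A. (a, u) \<in> r))"


section \<open>Spaces\<close>

definition tychonoff_space :: "'a topology \<Rightarrow> bool" where
  "tychonoff_space X \<longleftrightarrow> completely_regular_space X \<and> Hausdorff_space X"

text \<open>A filter on the set \<open>S\<close> is an element \<open>F \<le> principal S\<close> of the library type of filters on
  the ambient type; a subset \<open>U\<close> of \<open>S\<close> belongs to it iff \<open>eventually (\<lambda>s. s \<in> U) F\<close>. The improper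
  filter \<open>bot\<close>, which corresponds to the whole power set of \<open>S\<close>, is not excluded.\<close>

definition free_filter_on :: "'s set \<Rightarrow> 's filter \<Rightarrow> bool" where
  "free_filter_on S F \<longleftrightarrow>
     F \<le> principal S \<and> \<Inter>{U. U \<subseteq> S \<and> eventually (\<lambda>s. s \<in> U) F} = {}"

text \<open>The space \<open>S(F)\<close>; the point \<open>*\<close> is rendered as \<open>None\<close>.\<close>

definition filter_space :: "'s set \<Rightarrow> 's filter \<Rightarrow> 's option topology" where
  "filter_space S F = topology (\<lambda>W. W \<subseteq> insert None (Some ` S) \<and>
     (None \<in> W \<longrightarrow> eventually (\<lambda>s. Some s \<in> W) F))"

lemma openin_filter_space:
  "openin (filter_space S F) W \<longleftrightarrow> W \<subseteq> insert None (Some ` S) \<and>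
     (None \<in> W \<longrightarrow> eventually (\<lambda>s. Some s \<in> W) F)"
proof -
  have "istopology (\<lambda>W. W \<subseteq> insert None (Some ` S) \<and>
     (None \<in> W \<longrightarrow> eventually (\<lambda>s. Some s \<in> W) F))"
    unfolding istopology_def
  proof (intro conjI allI impI)
    fix \<K> assume *: "\<forall>W\<in>\<K>. W \<subseteq> insert None (Some ` S) \<and>
      (None \<in> W \<longrightarrow> eventually (\<lambda>s. Some s \<in> W) F)"
    then show "\<Union>\<K> \<subseteq> insert None (Some ` S)" by blast
    assume "None \<in> \<Union>\<K>"
    then obtain W where W: "W \<in> \<K>" "eventually (\<lambda>s. Some s \<in> W) F" using * by blast
    show "eventually (\<lambda>s. Some s \<in> \<Union>\<K>) F"
      by (rule eventually_mono[OF W(2)]) (use W(1) in blast)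
  qed (auto intro: eventually_conj)
  then show ?thesis
    unfolding filter_space_def by (simp add: topology_inverse')
qed

lemma topspace_filter_space:
  assumes "F \<le> principal S"
  shows "topspace (filter_space S F) = insert None (Some ` S)"
proof -
  have "eventually (\<lambda>s. s \<in> S) F"
    using assms by (simp add: le_principal)
  then have "openin (filter_space S F) (insert None (Some ` S))"
    unfolding openin_filter_space by (auto elim: eventually_mono)
  moreover have "topspace (filter_space S F) \<subseteq> insert None (Some ` S)"
    using openin_filter_space openin_topspace by blast
  ultimately show ?thesis
    by (meson openin_subset subset_antisym)
qed

text \<open>The product topology lives on extensional functions, so each continuous function on \<open>Z\<close>
  is represented exactly once.\<close>

definition Cp_space :: "'z topology \<Rightarrow> ('z \<Rightarrow> real) topology" where
  "Cp_space Z = subtopology (product_topology (\<lambda>_. euclideanreal) (topspace Z))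
     {f. continuous_map Z euclideanreal f}"

definition embeds_in :: "'a topology \<Rightarrow> 'b topology \<Rightarrow> bool" where
  "embeds_in X Y \<longleftrightarrow> (\<exists>f. embedding_map X Y f)"


section \<open>Ordered collections\<close>

definition ordered_as :: "'p set \<Rightarrow> 'p rel \<Rightarrow> ('p \<Rightarrow> 'c set) \<Rightarrow> 'c set \<Rightarrow> bool" where
  "ordered_as P r Cf \<C> \<longleftrightarrow> \<C> = (\<Union>p\<in>P. Cf p) \<and>
     (\<forall>p\<in>P. \<forall>q\<in>P. (p, q) \<in> r \<longrightarrow> Cf p \<subseteq> Cf q)"

definition P_property :: "'p set \<Rightarrow> 'p rel \<Rightarrow> ('c set \<Rightarrow> bool) \<Rightarrow> 'c set \<Rightarrow> bool" where
  "P_property P r Q \<C> \<longleftrightarrow> (\<exists>Cf. ordered_as P r Cf \<C> \<and> (\<forall>p\<in>P. Q (Cf p)))"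

definition has_ordered_compact_cover :: "'p set \<Rightarrow> 'p rel \<Rightarrow> 'z topology \<Rightarrow> bool" where
  "has_ordered_compact_cover P r Z \<longleftrightarrow>
     (\<exists>C. ordered_as P r C (topspace Z) \<and> (\<forall>p\<in>P. compactin Z (C p)))"


section \<open>Noetherian families\<close>

definition Noetherian_family :: "'a set set \<Rightarrow> bool" where
  "Noetherian_family \<C> \<longleftrightarrow>
     (\<forall>\<D>. \<D> \<subseteq> \<C> \<and> well_order_on \<D> (relation_of (\<subseteq>) \<D>) \<longrightarrow> finite \<D>)"

definition additively_Noetherian :: "'a set set \<Rightarrow> bool" where
  "additively_Noetherian \<C> \<longleftrightarrow> Noetherian_family {\<Union>\<A> | \<A>. \<A> \<subseteq> \<C>}"

definition point_finite :: "'a topology \<Rightarrow> 'a set set \<Rightarrow> bool" where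
  "point_finite X \<C> \<longleftrightarrow> (\<forall>x\<in>topspace X. finite {C \<in> \<C>. x \<in> C})"

definition point_additively_Noetherian :: "'a topology \<Rightarrow> 'a set set \<Rightarrow> bool" where
  "point_additively_Noetherian X \<C> \<longleftrightarrow>
     (\<forall>x\<in>topspace X. additively_Noetherian {C \<in> \<C>. x \<in> C})"

definition point_additively_Noetherian_pairs ::
    "'a topology \<Rightarrow> ('a set \<times> 'a set) set \<Rightarrow> bool" where
  "point_additively_Noetherian_pairs X \<N> \<longleftrightarrow>
     (\<forall>x\<in>topspace X. additively_Noetherian (fst ` {(N, V). (N, V) \<in> \<N> \<and> x \<in> V}))"


section \<open>Bases, almost subbases, networks\<close>

definition base_of :: "'a topology \<Rightarrow> 'a set set \<Rightarrow> bool" where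
  "base_of X \<B> \<longleftrightarrow> openin X = arbitrary union_of (\<lambda>B. B \<in> \<B>)"

text \<open>The empty intersection, taken relative to the space, is the whole space.\<close>

definition subbase_of :: "'a topology \<Rightarrow> 'a set set \<Rightarrow> bool" where
  "subbase_of X \<S> \<longleftrightarrow> (\<forall>A\<in>\<S>. A \<subseteq> topspace X) \<and>
     openin X = arbitrary union_of (finite intersection_of (\<lambda>A. A \<in> \<S>) relative_to topspace X)"

definition zero_set :: "'a topology \<Rightarrow> 'a set \<Rightarrow> bool" where
  "zero_set X Z \<longleftrightarrow> (\<exists>f. continuous_map X (top_of_set {0..1::real}) f \<and>
     Z = {x \<in> topspace X. f x = 0})"

definition cozero_set :: "'a topology \<Rightarrow> 'a set \<Rightarrow> bool" where
  "cozero_set X Z \<longleftrightarrow> (\<exists>f. continuous_map X (top_of_set {0..1::real}) f \<and>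
     Z = {x \<in> topspace X. f x \<noteq> 0})"

text \<open>Representing sequences are indexed from \<open>1\<close>; their value at \<open>0\<close> is irrelevant.\<close>

definition U_representation :: "'a topology \<Rightarrow> 'a set \<Rightarrow> (nat \<Rightarrow> 'a set) \<Rightarrow> bool" where
  "U_representation X V U \<longleftrightarrow> V = (\<Union>n\<in>{1..}. U n) \<and>
     (\<forall>n\<ge>1. U n \<subseteq> U (n + 1) \<and> zero_set X (U (2 * n - 1)) \<and> cozero_set X (U (2 * n)))"

definition almost_subbase :: "'a topology \<Rightarrow> 'a set set \<Rightarrow> bool" where
  "almost_subbase X \<alpha> \<longleftrightarrow> (\<forall>V\<in>\<alpha>. V \<subseteq> topspace X) \<and>
     (\<exists>U. (\<forall>V\<in>\<alpha>. U_representation X V (U V)) \<and>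
       subbase_of X (\<alpha> \<union> {topspace X - U V (2 * n - 1) | V n. V \<in> \<alpha> \<and> n \<ge> 1}))"

definition expandable_network :: "'a topology \<Rightarrow> ('a set \<times> 'a set) set \<Rightarrow> bool" where
  "expandable_network X \<N> \<longleftrightarrow>
     (\<forall>(N, V)\<in>\<N>. N \<subseteq> V \<and> openin X V) \<and>
     (\<forall>x U. openin X U \<and> x \<in> U \<longrightarrow> (\<exists>(N, V)\<in>\<N>. x \<in> N \<and> N \<subseteq> U))"

text \<open>\<open>W p x\<close> is the \<open>p\<close>-th piece of the collection attached to the point \<open>x\<close>.\<close>

definition P_pointed_family :: "'p set \<Rightarrow> 'p rel \<Rightarrow> ('a set set \<Rightarrow> bool) \<Rightarrow> 'a topology \<Rightarrow>
    ('p \<Rightarrow> 'a \<Rightarrow> 'a set set) \<Rightarrow> bool" where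
  "P_pointed_family P r Q X W \<longleftrightarrow>
     (\<forall>x\<in>topspace X.
        (\<forall>p\<in>P. Q (W p x) \<and> (\<forall>A\<in>W p x. A \<subseteq> topspace X \<and> x \<in> A)) \<and>
        (\<forall>p\<in>P. \<forall>q\<in>P. (p, q) \<in> r \<longrightarrow> W p x \<subseteq> W q x))"

definition P_point_network :: "'p set \<Rightarrow> 'p rel \<Rightarrow> ('a set set \<Rightarrow> bool) \<Rightarrow> 'a topology \<Rightarrow>
    ('p \<Rightarrow> 'a \<Rightarrow> 'a set set) \<Rightarrow> bool" where
  "P_point_network P r Q X W \<longleftrightarrow> P_pointed_family P r Q X W \<and>
     (\<forall>x U. openin X U \<and> x \<in> U \<longrightarrow>
        (\<exists>V p. openin X V \<and> x \<in> V \<and> V \<subseteq> U \<and> p \<in> P \<and>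
           (\<forall>y\<in>V. \<exists>A\<in>W p y. x \<in> A \<and> A \<subseteq> U)))"

definition P_strong_point_network :: "'p set \<Rightarrow> 'p rel \<Rightarrow> ('a set set \<Rightarrow> bool) \<Rightarrow> 'a topology \<Rightarrow>
    ('p \<Rightarrow> 'a \<Rightarrow> 'a set set) \<Rightarrow> bool" where
  "P_strong_point_network P r Q X W \<longleftrightarrow> P_pointed_family P r Q X W \<and>
     (\<forall>x U. openin X U \<and> x \<in> U \<longrightarrow>
        (\<exists>V p. openin X V \<and> x \<in> V \<and> V \<subseteq> U \<and> p \<in> P \<and>
           (\<forall>y\<in>V. \<exists>A\<in>W p y. x \<in> A \<and> A \<subseteq> V)))"


section \<open>Embedding into function spaces of filter spaces\<close>

text \<open>Sets \<open>S\<close> range over the subsets of the type \<open>'s\<close>, passed as a type argument since HOL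
  cannot quantify over types inside a formula. The universe \<open>'a set \<times> nat\<close> is large enough for
  a space on \<open>'a\<close>: from an almost subbase \<open>\<alpha>\<close> one obtains coordinates indexed by \<open>\<alpha> \<times> nat\<close>.\<close>

definition embeds_in_Cp_of_filter_space ::
    "'s itself \<Rightarrow> 'p set \<Rightarrow> 'p rel \<Rightarrow> 'a topology \<Rightarrow> bool" where
  "embeds_in_Cp_of_filter_space _ P r X \<longleftrightarrow>
     (\<exists>(S::'s set) F. infinite S \<and> free_filter_on S F \<and>
        has_ordered_compact_cover P r (filter_space S F) \<and>
        embeds_in X (Cp_space (filter_space S F)))"

end

theory Submission
  imports Defs "HOL-Library.Ramsey"
begin

text \<open>The implication that carries the theorem is the one from point networks to almost subbases; the
others are short. Three ideas do the work.

\<^bold>\<open>Noetherian families as sequences.\<close> A family is additively Noetherian iff there are no members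
\<open>A\<^sub>0, A\<^sub>1, \<dots>\<close> and points \<open>x\<^sub>i \<in> A\<^sub>i\<close> such that \<open>x\<^sub>i\<close> avoids every earlier \<open>A\<^sub>j\<close>. By Ramsey's
theorem, any choice of points \<open>x\<^sub>i \<in> A\<^sub>i\<close> then has a subsequence along which \<open>x\<^sub>i\<close> lies in every
earlier \<open>A\<^sub>j\<close> (\<open>additively_Noetherian_perfect_subsequence\<close>). This makes the notion stable under
finite unions and pairwise intersections.

\<^bold>\<open>Failure of countable directedness.\<close> A countable unbounded subset of \<open>P\<close> gives a monotone unbounded
map \<open>P \<rightarrow> \<nat>\<close>. Hence a family indexed by \<open>\<nat> \<times> P\<close> can be re-indexed by \<open>P\<close> alone
(\<open>P_property_of_double_index\<close>), so that countably many constructions may be combined.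

\<^bold>\<open>From a point network to a separating family.\<close> Let \<open>W\<^sub>p(y)\<close> be the pieces of the network at \<open>y\<close>.

For a fixed \<open>y\<close> there is a \<open>P\<close>-point finite family \<open>E(y)\<close> of cozero sets which, whenever
\<open>c \<in> A \<in> W\<^sub>p(y)\<close> and \<open>z\<close> is outside the closure of \<open>A\<close>, has a member containing \<open>z\<close> whose closure
misses \<open>c\<close> (\<open>point_finite_family_separating_from_Noetherian_families\<close>). It is built greedily along a
well-order of all pairs of a set \<open>A\<close> of the network at \<open>y\<close> and a continuous function vanishing on it.
A pair is responsible only for those points that do not already lie in finitely many earlier open
sets whose sets \<open>A\<close> cover the present one. These points form a countable union of compact sets, and
by compactness each of these sets has one cozero neighbourhood with one label \<open>p\<close>; working with
compact sets rather than points is what makes the weak form of the network condition suffice. If a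
point \<open>w\<close> were in infinitely many of these neighbourhoods with labels below \<open>q\<close>, the Noetherian property of \<open>W\<^sub>q(w)\<close>, in the Ramsey form, and that of \<open>W\<^sub>q(y)\<close> would
produce a point that had been taken care of earlier.

Using \<open>E(y)\<close> for all \<open>y\<close> at once would destroy point finiteness. Instead a base point is chosen in
each nonempty finite intersection \<open>G\<close> of sets obtained so far, and \<open>E\<close> of that base point is used
only inside \<open>G\<close>. Each round adds finitely many sets at each point, for each label. If \<open>G\<close> shrinks
through the finite intersections containing a point \<open>z\<close>, the base points converge to \<open>z\<close>
(\<open>base_points_converge\<close>): near a cluster point \<open>c \<noteq> z\<close> there would be a base point with a network
set that contains \<open>c\<close> and has \<open>z\<close> outside its closure, and a member of \<open>E\<close> of this base point would
keep all later base points away from \<open>c\<close>. Two points that belong to the same sets of the family are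
therefore limits of the same net, hence equal.

In a compact space a family of functions that separates the points yields an almost subbase, because
the topology that the almost subbase generates is Hausdorff and coarser than the given one
(\<open>almost_subbase_of_separating_family\<close>). The same fact gives the almost subbase of a subspace of
\<open>C\<^sub>p(S(F))\<close>, since on a compact subset of \<open>S(F)\<close> a continuous function is close to its value at \<open>*\<close>
off a finite set. In the opposite direction, complements of the zero sets \<open>U\<^bsub>2n-1\<^esub>(V)\<close> form, for
fixed \<open>n\<close> and label, an additively Noetherian family
(\<open>additively_Noetherian_complements_of_zero_sets\<close>), and this turns an almost subbase into a base.\<close>

section \<open>Infinite sequences\<close>

text \<open>Ramsey's theorem for pairs, read along an increasing enumeration of the homogeneous set.\<close>

lemma homogeneous_subsequence:
  fixes Q :: "nat \<Rightarrow> nat \<Rightarrow> bool"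
  obtains \<phi> where "strict_mono (\<phi> :: nat \<Rightarrow> nat)"
    "(\<forall>j i. j < i \<longrightarrow> Q (\<phi> j) (\<phi> i)) \<or> (\<forall>j i. j < i \<longrightarrow> \<not> Q (\<phi> j) (\<phi> i))"
proof -
  define f where "f e = (if Q (Min e) (Max e) then 0 else (1::nat))" for e :: "nat set"
  have "\<forall>x\<in>UNIV. \<forall>y\<in>UNIV. x \<noteq> y \<longrightarrow> f {x, y} < 2"
    by (auto simp: f_def)
  from Ramsey2[OF infinite_UNIV_nat this] obtain Y t
    where Y: "infinite Y" and t: "\<forall>x\<in>Y. \<forall>y\<in>Y. x \<noteq> y \<longrightarrow> f {x, y} = t"
    by auto
  define \<phi> where "\<phi> = enumerate Y"
  have mono: "strict_mono \<phi>"
    unfolding \<phi>_def using Y by (rule strict_mono_enumerate)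
  have in_Y: "\<phi> i \<in> Y" for i
    unfolding \<phi>_def using Y by (rule enumerate_in_set)
  have "f {\<phi> j, \<phi> i} = t" if "j < i" for i j
    using t in_Y strict_monoD[OF mono that] by (metis less_irrefl)
  moreover have "f {\<phi> j, \<phi> i} = (if Q (\<phi> j) (\<phi> i) then 0 else 1)" if "j < i" for i j
    using strict_monoD[OF mono that] by (simp add: f_def)
  ultimately have eq: "(if Q (\<phi> j) (\<phi> i) then 0 else 1) = t" if "j < i" for i j
    using that by metis
  have "(\<forall>j i. j < i \<longrightarrow> Q (\<phi> j) (\<phi> i)) \<or> (\<forall>j i. j < i \<longrightarrow> \<not> Q (\<phi> j) (\<phi> i))"
  proof (cases "t = 0")
    case True
    then show ?thesis using eq by (metis zero_neq_one)
  next
    case False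
    then show ?thesis using eq by metis
  qed
  with mono show ?thesis by (rule that)
qed

lemma increasing_sequence_in_infinite_set:
  assumes "wf R" and tot: "\<And>a b. a \<in> T \<Longrightarrow> b \<in> T \<Longrightarrow> a \<noteq> b \<Longrightarrow> (a, b) \<in> R \<or> (b, a) \<in> R"
    and "infinite T"
  shows "\<exists>s :: nat \<Rightarrow> 'a. (\<forall>i. s i \<in> T) \<and> (\<forall>j i. j < i \<longrightarrow> (s j, s i) \<in> R)"
proof -
  obtain f :: "nat \<Rightarrow> 'a" where f: "inj f" "range f \<subseteq> T"
    using \<open>infinite T\<close> infinite_countable_subset by blast
  obtain \<phi> :: "nat \<Rightarrow> nat" where mono: "strict_mono \<phi>"
    and hom: "(\<forall>j i. j < i \<longrightarrow> (f (\<phi> j), f (\<phi> i)) \<in> R) \<or>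
      (\<forall>j i. j < i \<longrightarrow> (f (\<phi> j), f (\<phi> i)) \<notin> R)"
    using homogeneous_subsequence[of "\<lambda>j i. (f j, f i) \<in> R"] by blast
  have ne: "f (\<phi> j) \<noteq> f (\<phi> i)" if "j < i" for i j
    using f(1) strict_monoD[OF mono that] by (metis injD less_irrefl)
  have T: "f (\<phi> i) \<in> T" for i
    using f(2) by blast
  have "\<not> (\<forall>j i. j < i \<longrightarrow> (f (\<phi> j), f (\<phi> i)) \<notin> R)"
  proof
    assume "\<forall>j i. j < i \<longrightarrow> (f (\<phi> j), f (\<phi> i)) \<notin> R"
    then have "(f (\<phi> (Suc i)), f (\<phi> i)) \<in> R" for i
      using tot[OF T T ne] lessI by blast
    then have "\<exists>g. \<forall>i. (g (Suc i), g i) \<in> R"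
      by (intro exI[of _ "\<lambda>i. f (\<phi> i)"]) simp
    then show False
      using \<open>wf R\<close> by (simp add: wf_iff_no_infinite_down_chain)
  qed
  with hom T show ?thesis by (intro exI[of _ "\<lambda>i. f (\<phi> i)"]) simp
qed

section \<open>Additively Noetherian families\<close>

text \<open>The unions of the initial segments of a sequence \<open>(A\<^sub>i, x\<^sub>i)\<close> whose points are always new form a chain
of type \<open>\<omega>\<close>; conversely, an infinite well-ordered chain of unions contains such a chain, and each of
its steps supplies a new point together with a member that contains it.\<close>

lemma additively_Noetherian_iff:
  "additively_Noetherian \<C> \<longleftrightarrow>
     (\<forall>A x. (\<forall>i::nat. A i \<in> \<C> \<and> x i \<in> A i) \<longrightarrow> (\<exists>i j. j < i \<and> x i \<in> A j))"
    (is "_ \<longleftrightarrow> ?R")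
proof
  assume N: "additively_Noetherian \<C>"
  show ?R
  proof (intro allI impI, rule ccontr)
    fix A :: "nat \<Rightarrow> 'a set" and x :: "nat \<Rightarrow> 'a"
    assume *: "\<forall>i. A i \<in> \<C> \<and> x i \<in> A i" and "\<nexists>i j. j < i \<and> x i \<in> A j"
    then have new: "x i \<notin> A j" if "j < i" for i j using that by blast
    define D where "D i = (\<Union>j\<le>i. A j)" for i
    have D_iff: "D i \<subseteq> D j \<longleftrightarrow> i \<le> j" for i j
    proof
      assume "D i \<subseteq> D j"
      then have "x i \<in> D j" using * unfolding D_def by blast
      then obtain k where "k \<le> j" "x i \<in> A k" unfolding D_def by blast
      then show "i \<le> j" using new[of k i] by force
    qed (unfold D_def, rule UN_mono, auto)
    have inj: "inj D" by (rule injI, rule order_antisym) (simp_all flip: D_iff)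
    let ?r = "relation_of (\<subseteq>) (range D)"
    have "wf (?r - Id)"
    proof (rule wf_subset[OF wf_inv_image[OF wf_less_than]])
      show "?r - Id \<subseteq> inv_image less_than (inv D)"
        using inj D_iff by (auto simp: relation_of_def inv_image_def less_le)
    qed
    moreover have "linear_order_on (range D) ?r"
      unfolding linear_order_on_def partial_order_on_def preorder_on_def
      using D_iff by (auto simp: relation_of_def refl_on_def trans_def antisym_def total_on_def)
    ultimately have "well_order_on (range D) ?r"
      by (simp add: well_order_on_def)
    moreover have "range D \<subseteq> {\<Union>\<A> | \<A>. \<A> \<subseteq> \<C>}"
    proof
      fix E assume "E \<in> range D"
      then obtain i where "E = \<Union>(A ` {..i})" unfolding D_def by blast
      moreover have "A ` {..i} \<subseteq> \<C>" using * by blast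
      ultimately show "E \<in> {\<Union>\<A> | \<A>. \<A> \<subseteq> \<C>}" by blast
    qed
    ultimately have "finite (range D)"
      using N unfolding additively_Noetherian_def Noetherian_family_def by blast
    then show False using inj finite_imageD infinite_UNIV_nat by blast
  qed
next
  assume R: ?R
  show "additively_Noetherian \<C>"
    unfolding additively_Noetherian_def Noetherian_family_def
  proof (intro allI impI, rule ccontr)
    fix \<D> assume D: "\<D> \<subseteq> {\<Union>\<A> | \<A>. \<A> \<subseteq> \<C>} \<and> well_order_on \<D> (relation_of (\<subseteq>) \<D>)"
      and inf: "infinite \<D>"
    let ?r = "relation_of (\<subseteq>) \<D>"
    have wf: "wf (?r - Id)" and lin: "linear_order_on \<D> ?r"
      using D by (auto simp: well_order_on_def)
    have tot: "(A, B) \<in> ?r - Id \<or> (B, A) \<in> ?r - Id" if "A \<in> \<D>" "B \<in> \<D>" "A \<noteq> B" for A B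
      using lin that by (auto simp: linear_order_on_def total_on_def)
    obtain s :: "nat \<Rightarrow> 'a set" where "(\<forall>i. s i \<in> \<D>) \<and> (\<forall>j i. j < i \<longrightarrow> (s j, s i) \<in> ?r - Id)"
      using increasing_sequence_in_infinite_set[OF wf tot inf] by (rule exE)
    then have s: "s i \<in> \<D>" "j < i \<Longrightarrow> (s j, s i) \<in> ?r - Id" for i j
      by blast+
    have "\<exists>x B. x \<in> B \<and> B \<in> \<C> \<and> B \<subseteq> s (Suc i) \<and> x \<notin> s i" for i
    proof -
      obtain \<A> where A: "s (Suc i) = \<Union>\<A>" "\<A> \<subseteq> \<C>" using s(1)[of "Suc i"] D by blast
      have "s i \<subset> s (Suc i)" using s(2)[of i "Suc i"] by (auto simp: relation_of_def)
      then obtain x where "x \<in> s (Suc i)" "x \<notin> s i" by blast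
      moreover from this obtain B where "B \<in> \<A>" "x \<in> B" unfolding A(1) by blast
      moreover have "B \<subseteq> s (Suc i)" unfolding A(1) using \<open>B \<in> \<A>\<close> by blast
      ultimately show ?thesis using A(2) by blast
    qed
    then obtain x B where xB: "\<And>i. x i \<in> B i \<and> B i \<in> \<C> \<and> B i \<subseteq> s (Suc i) \<and> x i \<notin> s i"
      by metis
    then obtain i j where ij: "j < i" "x i \<in> B j" using R by blast
    have "s (Suc j) \<subseteq> s i"
    proof (cases "Suc j = i")
      case False
      then have "Suc j < i" using ij(1) by simp
      then show ?thesis using s(2)[of "Suc j" i] by (auto simp: relation_of_def)
    qed simp
    then show False using xB ij by blast
  qed
qed

text \<open>Of the two alternatives of Ramsey's theorem, the family excludes the one in which no point lies in an
earlier set. The remaining one, with every point in every earlier set, can be thinned out further,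
and so it can be combined for several families.\<close>

lemma additively_Noetherian_perfect_subsequence:
  assumes "additively_Noetherian \<C>" "\<And>i::nat. A i \<in> \<C>" "\<And>i. x i \<in> A i"
  obtains \<phi> where "strict_mono (\<phi> :: nat \<Rightarrow> nat)" "\<And>j i. j < i \<Longrightarrow> x (\<phi> i) \<in> A (\<phi> j)"
proof -
  obtain \<phi> :: "nat \<Rightarrow> nat" where mono: "strict_mono \<phi>"
    and hom: "(\<forall>j i. j < i \<longrightarrow> x (\<phi> i) \<in> A (\<phi> j)) \<or> (\<forall>j i. j < i \<longrightarrow> x (\<phi> i) \<notin> A (\<phi> j))"
    using homogeneous_subsequence[of "\<lambda>j i. x i \<in> A j"] by blast
  have "\<exists>i j. j < i \<and> x (\<phi> i) \<in> A (\<phi> j)"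
    using assms(1)[unfolded additively_Noetherian_iff, rule_format,
        of "\<lambda>i. A (\<phi> i)" "\<lambda>i. x (\<phi> i)"] assms(2,3) by blast
  with hom mono that show ?thesis by blast
qed

text \<open>Otherwise each \<open>A\<^sub>i\<close> would contribute a point outside all earlier sets.\<close>

lemma additively_Noetherian_covered:
  assumes "additively_Noetherian \<C>" "\<And>i::nat. A i \<in> \<C>"
  obtains i where "A i \<subseteq> (\<Union>j<i. A j)"
proof (rule ccontr)
  assume "\<not> thesis"
  then have "\<exists>x. x \<in> A i - (\<Union>j<i. A j)" for i using that by blast
  then obtain x where x: "\<And>i. x i \<in> A i - (\<Union>j<i. A j)" by metis
  then have "\<exists>i j. j < i \<and> x i \<in> A j"
    using assms(1)[unfolded additively_Noetherian_iff, rule_format, of A x] assms(2) by simp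
  then show False using x by blast
qed

lemma additively_Noetherian_subset:
  "additively_Noetherian \<D> \<Longrightarrow> \<C> \<subseteq> \<D> \<Longrightarrow> additively_Noetherian \<C>"
  unfolding additively_Noetherian_iff by (meson subsetD)

lemma finite_imp_additively_Noetherian:
  assumes "finite \<C>" shows "additively_Noetherian \<C>"
  unfolding additively_Noetherian_iff
proof (intro allI impI)
  fix A :: "nat \<Rightarrow> 'a set" and x assume *: "\<forall>i. A i \<in> \<C> \<and> x i \<in> A i"
  then have "finite (range A)" by (intro finite_subset[OF _ assms]) auto
  then have "\<not> inj A" using finite_imageD infinite_UNIV_nat by blast
  then obtain j i where "j \<noteq> i" "A i = A j" by (auto simp: inj_def)
  then show "\<exists>i j. j < i \<and> x i \<in> A j" using * by (metis linorder_neqE_nat)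
qed

lemma additively_Noetherian_Un:
  assumes "additively_Noetherian \<C>" "additively_Noetherian \<D>"
  shows "additively_Noetherian (\<C> \<union> \<D>)"
  unfolding additively_Noetherian_iff
proof (intro allI impI)
  fix A :: "nat \<Rightarrow> 'a set" and x assume *: "\<forall>i. A i \<in> \<C> \<union> \<D> \<and> x i \<in> A i"
  have **: "\<exists>i j. j < i \<and> x i \<in> A j"
    if inf: "infinite {i. A i \<in> \<E>}" and \<E>: "additively_Noetherian \<E>" for \<E>
  proof -
    let ?e = "enumerate {i. A i \<in> \<E>}"
    have "A (?e i) \<in> \<E>" for i using enumerate_in_set[OF inf, of i] by simp
    then obtain i j where "j < i" "x (?e i) \<in> A (?e j)"
      using \<E>[unfolded additively_Noetherian_iff, rule_format,
          of "\<lambda>i. A (?e i)" "\<lambda>i. x (?e i)"] * by blast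
    then show ?thesis using enumerate_mono[OF _ inf] by blast
  qed
  have "{i. A i \<in> \<C>} \<union> {i. A i \<in> \<D>} = UNIV" using * by blast
  then have "infinite {i. A i \<in> \<C>} \<or> infinite {i. A i \<in> \<D>}"
    by (metis finite_UnI infinite_UNIV_nat)
  then show "\<exists>i j. j < i \<and> x i \<in> A j" using ** assms by blast
qed

lemma additively_Noetherian_finite_UN:
  assumes "finite I" "\<And>i. i \<in> I \<Longrightarrow> additively_Noetherian (\<C> i)"
  shows "additively_Noetherian (\<Union>i\<in>I. \<C> i)"
  using assms
  by (induction I rule: finite_induct)
    (auto intro: additively_Noetherian_Un finite_imp_additively_Noetherian)

text \<open>A subsequence that is perfect for the first factors stays perfect when it is thinned out for the
second ones.\<close>

lemma additively_Noetherian_Int: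
  assumes C: "additively_Noetherian \<C>" and D: "additively_Noetherian \<D>"
  shows "additively_Noetherian {A \<inter> B |A B. A \<in> \<C> \<and> B \<in> \<D>}"
  unfolding additively_Noetherian_iff
proof (intro allI impI)
  fix E :: "nat \<Rightarrow> 'a set" and x
  assume *: "\<forall>i. E i \<in> {A \<inter> B |A B. A \<in> \<C> \<and> B \<in> \<D>} \<and> x i \<in> E i"
  then have "\<forall>i. \<exists>A B. E i = A \<inter> B \<and> A \<in> \<C> \<and> B \<in> \<D>" by blast
  then obtain A B where AB: "\<And>i. E i = A i \<inter> B i" "\<And>i. A i \<in> \<C>" "\<And>i. B i \<in> \<D>" by metis
  have x: "x i \<in> A i" "x i \<in> B i" for i using * AB(1) by auto
  obtain \<phi> :: "nat \<Rightarrow> nat" where \<phi>: "strict_mono \<phi>" "\<And>j i. j < i \<Longrightarrow> x (\<phi> i) \<in> A (\<phi> j)"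
    by (rule additively_Noetherian_perfect_subsequence[OF C, where A = A and x = x, OF AB(2) x(1)])
      (rule that)
  have "\<exists>i j. j < i \<and> x (\<phi> i) \<in> B (\<phi> j)"
    using D[unfolded additively_Noetherian_iff, rule_format,
        of "\<lambda>i. B (\<phi> i)" "\<lambda>i. x (\<phi> i)"] x(2) AB(3) by simp
  then obtain i j where "j < i" "x (\<phi> i) \<in> B (\<phi> j)" by blast
  moreover from this have "\<phi> j < \<phi> i" "x (\<phi> i) \<in> A (\<phi> j)"
    using \<phi> by (auto simp: strict_mono_less)
  ultimately have "\<phi> j < \<phi> i \<and> x (\<phi> i) \<in> E (\<phi> j)" using AB(1) by simp
  then show "\<exists>i j. j < i \<and> x i \<in> E j" by blast
qed

text \<open>If some \<open>x\<^sub>i\<close> with \<open>i > 0\<close> is the added point \<open>y\<close>, it lies in \<open>A\<^sub>0\<close>; otherwise the sequence from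
index \<open>1\<close> on lives in the original family.\<close>

lemma additively_Noetherian_insert_point:
  assumes "additively_Noetherian \<C>"
  shows "additively_Noetherian (insert y ` \<C>)"
  unfolding additively_Noetherian_iff
proof (intro allI impI)
  fix E :: "nat \<Rightarrow> 'a set" and x
  assume *: "\<forall>i. E i \<in> insert y ` \<C> \<and> x i \<in> E i"
  then have "\<forall>i. \<exists>A. E i = insert y A \<and> A \<in> \<C>" by blast
  then obtain A where A: "\<And>i. E i = insert y (A i)" "\<And>i. A i \<in> \<C>" by metis
  show "\<exists>i j. j < i \<and> x i \<in> E j"
  proof (cases "\<exists>i>0. x i = y")
    case True
    then show ?thesis using A by blast
  next
    case False
    then have "x (Suc i) \<in> A (Suc i)" for i using * A by blast
    then obtain i j where "j < i" "x (Suc i) \<in> A (Suc j)"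
      using assms[unfolded additively_Noetherian_iff, rule_format,
          of "\<lambda>i. A (Suc i)" "\<lambda>i. x (Suc i)"] A by blast
    then show ?thesis using A(1) by blast
  qed
qed

section \<open>Directed sets that are not countably directed\<close>

lemma directed_set_finite_bound:
  assumes "directed_set P r" "finite A" "A \<subseteq> P"
  obtains u where "u \<in> P" "\<And>a. a \<in> A \<Longrightarrow> (a, u) \<in> r"
proof -
  have "\<exists>u\<in>P. \<forall>a\<in>A. (a, u) \<in> r"
    using assms(2,3)
  proof (induction A rule: finite_induct)
    case empty
    then show ?case using assms(1) by (auto simp: directed_set_def)
  next
    case (insert a A)
    then obtain u where u: "u \<in> P" "\<forall>a\<in>A. (a, u) \<in> r" by auto
    then obtain v where "v \<in> P" "(a, v) \<in> r" "(u, v) \<in> r"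
      using insert.prems assms(1) unfolding directed_set_def by blast
    moreover have "trans r"
      using assms(1) by (auto simp: directed_set_def partial_order_on_def preorder_on_def)
    ultimately have "\<forall>b\<in>insert a A. (b, v) \<in> r" using u by (auto dest: transD)
    then show ?case using \<open>v \<in> P\<close> by blast
  qed
  then show ?thesis using that by blast
qed

lemma directed_set_trans: "directed_set P r \<Longrightarrow> (p, q) \<in> r \<Longrightarrow> (q, s) \<in> r \<Longrightarrow> (p, s) \<in> r"
  by (auto simp: directed_set_def partial_order_on_def preorder_on_def dest: transD)

text \<open>For an unbounded sequence \<open>a\<close> in \<open>P\<close>, let \<open>h p\<close> be the first index \<open>n\<close> for which \<open>a n\<close> is not below \<open>p\<close>.\<close>

lemma unbounded_monotone_rank:
  assumes dir: "directed_set P r" and "\<not> countably_directed P r"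
  obtains h :: "'p \<Rightarrow> nat" where "\<And>p q. p \<in> P \<Longrightarrow> q \<in> P \<Longrightarrow> (p, q) \<in> r \<Longrightarrow> h p \<le> h q"
    "\<And>n. \<exists>p\<in>P. n \<le> h p"
proof -
  obtain A where A: "A \<subseteq> P" "countable A" and unb: "\<not> (\<exists>u\<in>P. \<forall>a\<in>A. (a, u) \<in> r)"
    using assms(2) unfolding countably_directed_def by blast
  have "A \<noteq> {}"
    using unb dir by (auto simp: directed_set_def)
  define a where "a = from_nat_into A"
  have range_a: "range a = A"
    unfolding a_def using \<open>A \<noteq> {}\<close> A(2) by (rule range_from_nat_into)
  define h where "h p = (LEAST n. (a n, p) \<notin> r)" for p
  have ex: "\<exists>n. (a n, p) \<notin> r" if "p \<in> P" for p
    using unb that range_a by blast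
  have below: "(a m, p) \<in> r" if "m < h p" for m p
    using not_less_Least[OF that[unfolded h_def]] by blast
  have h_ge: "n \<le> h p" if "p \<in> P" "\<And>m. m < n \<Longrightarrow> (a m, p) \<in> r" for n p
    using LeastI_ex[OF ex[OF that(1)]] that(2) unfolding h_def by (meson not_le)
  show ?thesis
  proof (rule that)
    show "h p \<le> h q" if "p \<in> P" "q \<in> P" "(p, q) \<in> r" for p q
      by (rule h_ge[OF that(2)]) (metis below directed_set_trans[OF dir] that(3))
    show "\<exists>p\<in>P. n \<le> h p" for n
    proof -
      have "finite (a ` {..<n})" "a ` {..<n} \<subseteq> P" using A(1) range_a by auto
      then obtain u where "u \<in> P" "\<And>b. b \<in> a ` {..<n} \<Longrightarrow> (b, u) \<in> r"
        using directed_set_finite_bound[OF dir] by metis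
      then show ?thesis using h_ge[of u n] by auto
    qed
  qed
qed

text \<open>With the rank \<open>h\<close>, the family \<open>Cf (h p) p\<close> has the same union as the doubly indexed one: directedness
allows to enlarge a label until its rank exceeds a given \<open>n\<close>. All constructions below that need
countably many stages end with this step.\<close>

lemma P_property_of_double_index:
  assumes dir: "directed_set P r" and ncd: "\<not> countably_directed P r"
    and mono: "\<And>m (n::nat) p q. m \<le> n \<Longrightarrow> p \<in> P \<Longrightarrow> q \<in> P \<Longrightarrow> (p, q) \<in> r \<Longrightarrow> Cf m p \<subseteq> Cf n q"
    and Q: "\<And>n p. p \<in> P \<Longrightarrow> Q (Cf n p)"
  shows "P_property P r Q (\<Union>n. \<Union>p\<in>P. Cf n p)"
proof -
  obtain h :: "'a \<Rightarrow> nat" where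
    h: "\<And>p q. p \<in> P \<Longrightarrow> q \<in> P \<Longrightarrow> (p, q) \<in> r \<Longrightarrow> h p \<le> h q" "\<And>n. \<exists>p\<in>P. n \<le> h p"
    using unbounded_monotone_rank[OF dir ncd] by metis
  have "(\<Union>n. \<Union>p\<in>P. Cf n p) = (\<Union>p\<in>P. Cf (h p) p)"
  proof (intro subset_antisym subsetI)
    fix C assume "C \<in> (\<Union>n. \<Union>p\<in>P. Cf n p)"
    then obtain n p where np: "p \<in> P" "C \<in> Cf n p" by blast
    obtain q where q: "q \<in> P" "n \<le> h q" using h(2) by blast
    obtain u where u: "u \<in> P" "(p, u) \<in> r" "(q, u) \<in> r"
      using dir np q unfolding directed_set_def by blast
    have "n \<le> h u" using q u h(1) by (meson order_trans)
    then have "C \<in> Cf (h u) u" using mono[of n "h u" p u] np u by blast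
    then show "C \<in> (\<Union>p\<in>P. Cf (h p) p)" using u(1) by blast
  qed blast
  then show ?thesis
    unfolding P_property_def ordered_as_def
    using mono h(1) Q by (intro exI[of _ "\<lambda>p. Cf (h p) p"]) (auto 4 3)
qed

lemma finite_subset_of_double_index:
  fixes F :: "nat \<Rightarrow> 'p \<Rightarrow> 'c set"
  assumes dir: "directed_set P r"
    and mono: "\<And>m n p q. m \<le> n \<Longrightarrow> p \<in> P \<Longrightarrow> q \<in> P \<Longrightarrow> (p, q) \<in> r \<Longrightarrow> F m p \<subseteq> F n q"
    and \<S>: "finite \<S>" "\<S> \<subseteq> (\<Union>n. \<Union>p\<in>P. F n p)" and q: "q \<in> P"
  shows "\<exists>n\<ge>m. \<exists>u\<in>P. (q, u) \<in> r \<and> \<S> \<subseteq> F n u"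
proof -
  have "\<forall>S\<in>\<S>. \<exists>n p. p \<in> P \<and> S \<in> F n p" using \<S>(2) by blast
  then obtain n p where np: "\<And>S. S \<in> \<S> \<Longrightarrow> p S \<in> P \<and> S \<in> F (n S) (p S)" by metis
  have "finite (insert q (p ` \<S>))" "insert q (p ` \<S>) \<subseteq> P" using \<S>(1) np q by auto
  then obtain u where u: "u \<in> P" "\<And>s. s \<in> insert q (p ` \<S>) \<Longrightarrow> (s, u) \<in> r"
    using directed_set_finite_bound[OF dir] by metis
  have "\<S> \<subseteq> F (m + (\<Sum>S\<in>\<S>. n S)) u"
  proof
    fix S assume S: "S \<in> \<S>"
    then have "n S \<le> m + (\<Sum>S\<in>\<S>. n S)" using \<S>(1) by (simp add: member_le_sum trans_le_add2)
    then show "S \<in> F (m + (\<Sum>S\<in>\<S>. n S)) u" using mono np[OF S] u S by blast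
  qed
  then show ?thesis using u by (intro exI[of _ "m + (\<Sum>S\<in>\<S>. n S)"]) auto
qed

section \<open>Zero sets and cozero sets\<close>

lemma continuous_map_unit_intervalD:
  assumes "continuous_map X (top_of_set {0..1::real}) f"
  shows "continuous_map X euclideanreal f" "x \<in> topspace X \<Longrightarrow> 0 \<le> f x"
  using assms by (auto simp: continuous_map_in_subtopology)

lemma openin_superlevel:
  fixes f :: "'a \<Rightarrow> real"
  assumes "continuous_map X euclideanreal f"
  shows "openin X {x \<in> topspace X. a < f x}"
  using assms continuous_map_upper_lower_semicontinuous_lt[of X f] by simp

lemma closedin_superlevel:
  fixes f :: "'a \<Rightarrow> real"
  assumes "continuous_map X euclideanreal f"
  shows "closedin X {x \<in> topspace X. a \<le> f x}"
  using assms continuous_map_upper_lower_semicontinuous_le[of X f] by simp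

lemma cozero_setI_superlevel:
  fixes f :: "'a \<Rightarrow> real"
  assumes "continuous_map X euclideanreal f"
  shows "cozero_set X {x \<in> topspace X. a < f x}"
  unfolding cozero_set_def
proof (intro exI conjI)
  show "continuous_map X (top_of_set {0..1}) (\<lambda>x. min 1 (max 0 (f x - a)))"
    using assms by (auto simp: continuous_map_in_subtopology intro!: continuous_intros)
  show "{x \<in> topspace X. a < f x} = {x \<in> topspace X. min 1 (max 0 (f x - a)) \<noteq> 0}"
    by (auto simp: min_def max_def)
qed

lemma zero_setI_superlevel:
  fixes f :: "'a \<Rightarrow> real"
  assumes "continuous_map X euclideanreal f"
  shows "zero_set X {x \<in> topspace X. a \<le> f x}"
  unfolding zero_set_def
proof (intro exI conjI)
  show "continuous_map X (top_of_set {0..1}) (\<lambda>x. min 1 (max 0 (a - f x)))"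
    using assms by (auto simp: continuous_map_in_subtopology intro!: continuous_intros)
  show "{x \<in> topspace X. a \<le> f x} = {x \<in> topspace X. min 1 (max 0 (a - f x)) = 0}"
    by (auto simp: min_def max_def)
qed

lemma cozero_setD:
  assumes "cozero_set X V"
  shows "\<exists>f. continuous_map X euclideanreal f \<and> (\<forall>x\<in>topspace X. 0 \<le> f x) \<and> V = {x \<in> topspace X. 0 < f x}"
proof -
  obtain f where f: "continuous_map X (top_of_set {0..1::real}) f" "V = {x \<in> topspace X. f x \<noteq> 0}"
    using assms unfolding cozero_set_def by blast
  note D = continuous_map_unit_intervalD[OF f(1)]
  have "V = {x \<in> topspace X. 0 < f x}" unfolding f(2) using D(2) by force
  then show ?thesis using D by blast
qed

lemma zero_setD:
  assumes "zero_set X V"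
  shows "\<exists>f. continuous_map X euclideanreal f \<and> (\<forall>x\<in>topspace X. 0 \<le> f x) \<and> V = {x \<in> topspace X. f x = 0}"
proof -
  obtain f where f: "continuous_map X (top_of_set {0..1::real}) f" "V = {x \<in> topspace X. f x = 0}"
    using assms unfolding zero_set_def by blast
  with continuous_map_unit_intervalD[OF f(1)] show ?thesis by blast
qed

lemma cozero_set_imp_openin: "cozero_set X V \<Longrightarrow> openin X V"
  using cozero_setD[of X V] openin_superlevel by blast

lemma zero_set_imp_closedin: "zero_set X V \<Longrightarrow> closedin X V"
proof -
  assume "zero_set X V"
  then obtain f where f: "continuous_map X euclideanreal f"
    "\<And>x. x \<in> topspace X \<Longrightarrow> 0 \<le> f x" "V = {x \<in> topspace X. f x = 0}"
    using zero_setD by blast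
  have "continuous_map X euclideanreal (\<lambda>x. - f x)" using f(1) by (intro continuous_intros)
  then have "closedin X {x \<in> topspace X. 0 \<le> - f x}" by (rule closedin_superlevel)
  moreover have "V = {x \<in> topspace X. 0 \<le> - f x}" unfolding f(3) using f(2) by force
  ultimately show "closedin X V" by simp
qed

lemma cozero_set_topspace: "cozero_set X (topspace X)"
  using cozero_setI_superlevel[of X "\<lambda>_. 1" 0] by simp

lemma cozero_set_Int:
  assumes "cozero_set X V" "cozero_set X V'"
  shows "cozero_set X (V \<inter> V')"
proof -
  obtain f where f: "continuous_map X euclideanreal f" "V = {x \<in> topspace X. 0 < f x}"
    using cozero_setD[OF assms(1)] by blast
  obtain f' where f': "continuous_map X euclideanreal f'" "V' = {x \<in> topspace X. 0 < f' x}"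
    using cozero_setD[OF assms(2)] by blast
  have "continuous_map X euclideanreal (\<lambda>x. min (f x) (f' x))"
    using f(1) f'(1) by (intro continuous_intros)
  moreover have "V \<inter> V' = {x \<in> topspace X. 0 < min (f x) (f' x)}"
    using f(2) f'(2) by auto
  ultimately show ?thesis using cozero_setI_superlevel by metis
qed

lemma cozero_set_finite_Inter:
  assumes "finite \<V>" "\<And>V. V \<in> \<V> \<Longrightarrow> cozero_set X V"
  shows "cozero_set X (topspace X \<inter> \<Inter>\<V>)"
  using assms
proof (induction \<V> rule: finite_induct)
  case (insert V \<V>)
  have "topspace X \<inter> \<Inter>(insert V \<V>) = V \<inter> (topspace X \<inter> \<Inter>\<V>)" by blast
  then show ?case using insert cozero_set_Int by (metis insertCI)
qed (simp add: cozero_set_topspace)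

lemma compact_Hausdorff_Urysohn:
  assumes "compact_space X" "Hausdorff_space X" "closedin X S" "openin X U" "S \<subseteq> U"
  shows "\<exists>f. continuous_map X euclideanreal f \<and> (\<forall>x\<in>S. f x = 1) \<and> (\<forall>x\<in>topspace X - U. f x = 0)"
proof -
  have "normal_space X"
    using assms(1,2) by (simp add: compact_Hausdorff_or_regular_imp_normal_space)
  moreover have "closedin X (topspace X - U)" using assms(4) by blast
  moreover have "disjnt (topspace X - U) S" using assms(5) by (auto simp: disjnt_def)
  ultimately obtain f :: "'a \<Rightarrow> real" where "continuous_map X euclideanreal f"
    "f ` (topspace X - U) \<subseteq> {0}" "f ` S \<subseteq> {1}"
    using Urysohn_lemma_alt[of X "topspace X - U" S 0 1] assms(3) by blast
  then show ?thesis by (intro exI[of _ f]) auto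
qed

section \<open>Separating points from a Noetherian family of sets\<close>

text \<open>The network condition for a compact set \<open>D\<close> in place of a point. The finitely many labels of a finite
subcover have a common upper bound, so one label serves all points of \<open>D\<close>. This is what makes a single
label available for a whole neighbourhood.\<close>

lemma point_network_closed_set:
  assumes dir: "directed_set P r" and comp: "compact_space X" and haus: "Hausdorff_space X"
    and net: "P_point_network P r Q X W"
    and D: "closedin X D" and U: "openin X U" "D \<subseteq> U"
  obtains V p where "cozero_set X V" "D \<subseteq> V" "V \<subseteq> U" "p \<in> P"
    "\<And>w. w \<in> V \<Longrightarrow> \<exists>A\<in>W p w. A \<inter> D \<noteq> {} \<and> A \<subseteq> U"
proof -
  have fam: "P_pointed_family P r Q X W"
    and nw: "\<And>x U. openin X U \<Longrightarrow> x \<in> U \<Longrightarrow>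
        (\<exists>V p. openin X V \<and> x \<in> V \<and> V \<subseteq> U \<and> p \<in> P \<and> (\<forall>y\<in>V. \<exists>A\<in>W p y. x \<in> A \<and> A \<subseteq> U))"
    using net by (auto simp: P_point_network_def)
  have "\<exists>V p. openin X V \<and> x \<in> V \<and> V \<subseteq> U \<and> p \<in> P \<and> (\<forall>y\<in>V. \<exists>A\<in>W p y. x \<in> A \<and> A \<subseteq> U)"
    if "x \<in> D" for x
    using nw U that by blast
  then obtain V p where V: "\<And>x. x \<in> D \<Longrightarrow> openin X (V x) \<and> x \<in> V x \<and> V x \<subseteq> U \<and> p x \<in> P \<and>
      (\<forall>y\<in>V x. \<exists>A\<in>W (p x) y. x \<in> A \<and> A \<subseteq> U)"
    by metis
  have "compactin X D" using comp D by (rule closedin_compact_space)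
  moreover have "\<forall>G\<in>V ` D. openin X G" "D \<subseteq> \<Union>(V ` D)" using V by auto
  ultimately obtain \<F> where "finite \<F>" "\<F> \<subseteq> V ` D" "D \<subseteq> \<Union>\<F>"
    unfolding compactin_def by meson
  then obtain I where I: "finite I" "I \<subseteq> D" "D \<subseteq> \<Union>(V ` I)"
    by (metis finite_subset_image)
  then obtain q where q: "q \<in> P" "\<And>s. s \<in> p ` I \<Longrightarrow> (s, q) \<in> r"
    using directed_set_finite_bound[OF dir, of "p ` I"] V by blast
  have "openin X (\<Union>(V ` I))" using V I(2) by blast
  from compact_Hausdorff_Urysohn[OF comp haus D this I(3)]
  obtain f where f: "continuous_map X euclideanreal f"
    "\<And>x. x \<in> D \<Longrightarrow> f x = 1" "\<And>x. x \<in> topspace X - \<Union>(V ` I) \<Longrightarrow> f x = 0"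
    by blast
  let ?G = "{x \<in> topspace X. 0 < f x}"
  have sub: "?G \<subseteq> \<Union>(V ` I)" using f(3) by force
  show ?thesis
  proof (rule that)
    show "cozero_set X ?G" using f(1) by (rule cozero_setI_superlevel)
    show "D \<subseteq> ?G" using f(2) closedin_subset[OF D] by auto
    show "?G \<subseteq> U" using sub V I(2) by blast
    fix w assume w: "w \<in> ?G"
    then obtain x where x: "x \<in> I" "w \<in> V x" using sub by blast
    then obtain A where A: "A \<in> W (p x) w" "x \<in> A" "A \<subseteq> U" using V I(2) by blast
    moreover have "W (p x) w \<subseteq> W q w"
      using fam w x(1) q V I(2) unfolding P_pointed_family_def by blast
    ultimately show "\<exists>A\<in>W q w. A \<inter> D \<noteq> {} \<and> A \<subseteq> U" using x(1) I(2) by blast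
  qed (fact q(1))
qed

text \<open>In a pair \<open>t = (A, f)\<close> of \<open>T\<close> the function \<open>f\<close> vanishes on \<open>A\<close>, so the closure of \<open>U t = {f > 1/2}\<close>
misses \<open>A\<close>. The set \<open>past t\<close> consists of the points that finitely many earlier \<open>U s\<close> have in common,
provided that the first components of these \<open>s\<close> cover \<open>A\<close>; for such points earlier pairs already
achieve the separation from \<open>A\<close>, by well-founded induction. The rest of \<open>U t\<close> is the union of the
closed sets \<open>D t n\<close>. The exact form of \<open>past t\<close> is dictated by point finiteness: a perfect subsequence
for the network at the common point \<open>w\<close> puts \<open>x\<^sub>i \<in> D t\<^sub>i n\<close> into all earlier \<open>U t\<^sub>j\<close>, while
the first component of some \<open>t\<^sub>i\<close> is covered by those of the earlier pairs, so \<open>x\<^sub>i \<in> past t\<^sub>i\<close>.\<close>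

lemma point_finite_family_separating_from_Noetherian_families:
  fixes X :: "'a topology" and \<W> :: "'p \<Rightarrow> 'a set set"
  assumes dir: "directed_set P r" and ncd: "\<not> countably_directed P r"
    and comp: "compact_space X" and haus: "Hausdorff_space X"
    and net: "P_point_network P r additively_Noetherian X N"
    and mono: "\<And>p q. p \<in> P \<Longrightarrow> q \<in> P \<Longrightarrow> (p, q) \<in> r \<Longrightarrow> \<W> p \<subseteq> \<W> q"
    and Noeth: "\<And>p. p \<in> P \<Longrightarrow> additively_Noetherian (\<W> p)"
  shows "\<exists>\<E>. P_property P r (point_finite X) \<E> \<and> (\<forall>V\<in>\<E>. cozero_set X V) \<and>
    (\<forall>p\<in>P. \<forall>A\<in>\<W> p. \<forall>c\<in>A \<inter> topspace X. \<forall>z\<in>topspace X - X closure_of A. \<exists>V\<in>\<E>. z \<in> V \<and> c \<notin> X closure_of V)"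
proof -
  define T :: "('a set \<times> ('a \<Rightarrow> real)) set" where
    "T = {(A, f). A \<in> (\<Union>p\<in>P. \<W> p) \<and> continuous_map X euclideanreal f \<and> (\<forall>x\<in>A. f x = 0)}"
  obtain r0 :: "('a set \<times> ('a \<Rightarrow> real)) rel" where "well_order_on UNIV r0"
    using well_order_on by blast
  define R where "R = r0 - Id"
  have wf: "wf R" and tot: "\<And>s t. s \<noteq> t \<Longrightarrow> (s, t) \<in> R \<or> (t, s) \<in> R"
    using \<open>well_order_on UNIV r0\<close>
    unfolding R_def well_order_on_def linear_order_on_def total_on_def by blast+
  define U where "U t = {x \<in> topspace X. 1/2 < snd t x}" for t :: "'a set \<times> ('a \<Rightarrow> real)"
  define past where "past t = (\<Union>J\<in>{J. finite J \<and> J \<subseteq> T \<and> (\<forall>s\<in>J. (s, t) \<in> R) \<and> fst t \<subseteq> (\<Union>s\<in>J. fst s)}.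
      topspace X \<inter> (\<Inter>s\<in>J. U s))" for t
  define D where "D t n = {x \<in> topspace X. 1/2 + 1 / (real n + 2) \<le> snd t x} - past t" for t and n :: nat
  have open_U: "openin X (U t)" if "t \<in> T" for t
    unfolding U_def using that by (intro openin_superlevel) (auto simp: T_def)
  have open_past: "openin X (past t)" for t
    unfolding past_def
  proof (intro openin_Union, safe)
    fix J assume "finite J" "J \<subseteq> T"
    then show "openin X (topspace X \<inter> (\<Inter>s\<in>J. U s))"
      by (intro openin_Int_Inter) (auto intro: open_U)
  qed
  have closed_D: "closedin X (D t n)" if "t \<in> T" for t n
    unfolding D_def using that open_past
    by (intro closedin_diff closedin_superlevel) (auto simp: T_def)
  have D_U: "D t n \<subseteq> U t" for t n
  proof -
    have "1/2 < 1/2 + 1 / (real n + 2)" by simp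
    then have "1/2 < snd t x" if "1/2 + 1 / (real n + 2) \<le> snd t x" for x
      using that by (rule less_le_trans)
    then show ?thesis unfolding D_def U_def by blast
  qed
  have "\<exists>V p. t \<in> T \<longrightarrow> cozero_set X V \<and> D t n \<subseteq> V \<and> V \<subseteq> U t \<and> p \<in> P \<and>
      (\<forall>w\<in>V. \<exists>A\<in>N p w. A \<inter> D t n \<noteq> {} \<and> A \<subseteq> U t)" for t n
    using point_network_closed_set[OF dir comp haus net closed_D open_U D_U] by metis
  then obtain V p where Vp: "\<And>t n. t \<in> T \<Longrightarrow> cozero_set X (V t n) \<and> D t n \<subseteq> V t n \<and> V t n \<subseteq> U t \<and>
      p t n \<in> P \<and> (\<forall>w\<in>V t n. \<exists>A\<in>N (p t n) w. A \<inter> D t n \<noteq> {} \<and> A \<subseteq> U t)"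
    by metis
  define E where "E n q = {V t m | t m. t \<in> T \<and> m \<le> n \<and> (p t m, q) \<in> r \<and> fst t \<in> \<W> q}"
    for n q
  have E_mono: "E m q \<subseteq> E n q'" if "m \<le> n" "q \<in> P" "q' \<in> P" "(q, q') \<in> r" for m n q q'
  proof
    fix G assume "G \<in> E m q"
    then obtain t k where "G = V t k" "t \<in> T" "k \<le> m" "(p t k, q) \<in> r" "fst t \<in> \<W> q"
      unfolding E_def by blast
    moreover from this have "(p t k, q') \<in> r" using directed_set_trans[OF dir] that by metis
    ultimately show "G \<in> E n q'" unfolding E_def using that mono[of q q'] by fastforce
  qed
  have E_pf: "point_finite X (E n q)" if q: "q \<in> P" for n q
    unfolding point_finite_def
  proof (intro ballI, rule ccontr)
    fix w assume w: "w \<in> topspace X" and inf: "infinite {G \<in> E n q. w \<in> G}"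
    let ?T = "\<lambda>m. {t \<in> T. (p t m, q) \<in> r \<and> fst t \<in> \<W> q \<and> w \<in> V t m}"
    have "{G \<in> E n q. w \<in> G} \<subseteq> (\<Union>m\<le>n. (\<lambda>t. V t m) ` ?T m)"
      unfolding E_def by blast
    then have "infinite (\<Union>m\<le>n. (\<lambda>t. V t m) ` ?T m)"
      using inf finite_subset by blast
    then obtain m where m: "infinite (?T m)" by blast
    have tot': "(s, t) \<in> R \<or> (t, s) \<in> R" if "s \<in> ?T m" "t \<in> ?T m" "s \<noteq> t" for s t
      using tot that by blast
    obtain s :: "nat \<Rightarrow> _" where "(\<forall>i. s i \<in> ?T m) \<and> (\<forall>j i. j < i \<longrightarrow> (s j, s i) \<in> R)"
      using increasing_sequence_in_infinite_set[OF wf tot' m] by (rule exE)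
    then have sT: "s i \<in> T" "fst (s i) \<in> \<W> q" "(p (s i) m, q) \<in> r" "w \<in> V (s i) m"
      and s_inc: "j < i \<Longrightarrow> (s j, s i) \<in> R" for i j
      by blast+
    have "\<exists>A x. A \<in> N q w \<and> x \<in> A \<and> x \<in> D (s i) m \<and> A \<subseteq> U (s i)" for i
    proof -
      have "p (s i) m \<in> P" using Vp[OF sT(1)] by blast
      then have "N (p (s i) m) w \<subseteq> N q w"
        using net w q sT(3) unfolding P_point_network_def P_pointed_family_def by blast
      then show ?thesis using Vp[OF sT(1)[of i]] sT(4)[of i] by blast
    qed
    then obtain A x where Ax: "\<And>i. A i \<in> N q w" "\<And>i. x i \<in> A i"
      "\<And>i. x i \<in> D (s i) m" "\<And>i. A i \<subseteq> U (s i)"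
      by metis
    \<comment> \<open>After passing to a subsequence, every \<open>x i\<close> lies in all earlier \<open>U (s j)\<close>.\<close>
    have "additively_Noetherian (N q w)"
      using net w q unfolding P_point_network_def P_pointed_family_def by blast
    from additively_Noetherian_perfect_subsequence[OF this, where A = A and x = x, OF Ax(1,2)]
    obtain \<phi> :: "nat \<Rightarrow> nat" where \<phi>: "strict_mono \<phi>" "\<And>j i. j < i \<Longrightarrow> x (\<phi> i) \<in> A (\<phi> j)"
      by metis
    \<comment> \<open>The Noetherian property at the given families makes one of the pairs superfluous for \<open>x i\<close>.\<close>
    obtain i where i: "fst (s (\<phi> i)) \<subseteq> (\<Union>j<i. fst (s (\<phi> j)))"
      using additively_Noetherian_covered[OF Noeth[OF q], where A = "\<lambda>i. fst (s (\<phi> i))"] sT(2)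
      by metis
    let ?J = "(\<lambda>j. s (\<phi> j)) ` {..<i}"
    have "x (\<phi> i) \<in> topspace X \<inter> (\<Inter>t\<in>?J. U t)"
    proof -
      have "x (\<phi> i) \<in> U (s (\<phi> j))" if "j < i" for j
        using \<phi>(2)[OF that] Ax(4) by blast
      moreover have "x (\<phi> i) \<in> topspace X" using Ax(3)[of "\<phi> i"] by (simp add: D_def)
      ultimately show ?thesis by blast
    qed
    moreover have "?J \<in> {J. finite J \<and> J \<subseteq> T \<and> (\<forall>t\<in>J. (t, s (\<phi> i)) \<in> R) \<and>
        fst (s (\<phi> i)) \<subseteq> (\<Union>t\<in>J. fst t)}"
      using sT(1) s_inc strict_monoD[OF \<phi>(1)] i by auto
    ultimately have "x (\<phi> i) \<in> past (s (\<phi> i))"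
      unfolding past_def by (rule UN_I[rotated])
    then show False using Ax(3) unfolding D_def by blast
  qed
  define \<E> where "\<E> = (\<Union>n. \<Union>q\<in>P. E n q)"
  have V_\<E>: "V t n \<in> \<E>" if t: "t \<in> T" for t n
  proof -
    obtain q where q: "q \<in> P" "fst t \<in> \<W> q" using t by (auto simp: T_def)
    have "p t n \<in> P" using Vp[OF t] by blast
    then obtain u where u: "u \<in> P" "(p t n, u) \<in> r" "(q, u) \<in> r"
      using dir q unfolding directed_set_def by blast
    then have "V t n \<in> E n u" unfolding E_def using t q mono[of q u] by blast
    then show ?thesis unfolding \<E>_def using u(1) by blast
  qed
  have sep: "\<exists>\<V>. finite \<V> \<and> \<V> \<subseteq> \<E> \<and> (\<forall>V\<in>\<V>. z \<in> V) \<and> fst t \<inter> topspace X \<inter> (\<Inter>V\<in>\<V>. X closure_of V) = {}"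
    if "t \<in> T" "z \<in> U t" for t z
    using wf that
  proof (induction t rule: wf_induct_rule)
    case (less t)
    show ?case
    proof (cases "z \<in> past t")
      case True
      then obtain J where J: "finite J" "J \<subseteq> T" "\<forall>s\<in>J. (s, t) \<in> R" "fst t \<subseteq> (\<Union>s\<in>J. fst s)"
        "\<forall>s\<in>J. z \<in> U s"
        unfolding past_def by blast
      have "\<forall>s\<in>J. \<exists>\<V>. finite \<V> \<and> \<V> \<subseteq> \<E> \<and> (\<forall>V\<in>\<V>. z \<in> V) \<and>
          fst s \<inter> topspace X \<inter> (\<Inter>V\<in>\<V>. X closure_of V) = {}"
      proof
        fix s assume "s \<in> J"
        then show "\<exists>\<V>. finite \<V> \<and> \<V> \<subseteq> \<E> \<and> (\<forall>V\<in>\<V>. z \<in> V) \<and>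
          fst s \<inter> topspace X \<inter> (\<Inter>V\<in>\<V>. X closure_of V) = {}"
          using less.IH[of s] J by (meson subsetD)
      qed
      then obtain \<V> where \<V>: "\<And>s. s \<in> J \<Longrightarrow> finite (\<V> s) \<and> \<V> s \<subseteq> \<E> \<and> (\<forall>V\<in>\<V> s. z \<in> V) \<and>
          fst s \<inter> topspace X \<inter> (\<Inter>V\<in>\<V> s. X closure_of V) = {}"
        by metis
      have "fst t \<inter> topspace X \<inter> (\<Inter>V\<in>(\<Union>s\<in>J. \<V> s). X closure_of V) = {}"
      proof (rule ccontr)
        assume "fst t \<inter> topspace X \<inter> (\<Inter>V\<in>(\<Union>s\<in>J. \<V> s). X closure_of V) \<noteq> {}"
        then obtain c where c: "c \<in> fst t" "c \<in> topspace X" "\<forall>s\<in>J. \<forall>V\<in>\<V> s. c \<in> X closure_of V"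
          by auto
        then obtain s where "s \<in> J" "c \<in> fst s" using J(4) by blast
        then show False using \<V>[of s] c by blast
      qed
      moreover have "finite (\<Union>s\<in>J. \<V> s)" "(\<Union>s\<in>J. \<V> s) \<subseteq> \<E>" "\<forall>V\<in>(\<Union>s\<in>J. \<V> s). z \<in> V"
        using \<V> J(1) by blast+
      ultimately show ?thesis by blast
    next
      case False
      have "0 < snd t z - 1/2" using less.prems(2) by (simp add: U_def)
      then obtain n where n: "1 / (real (Suc n)) < snd t z - 1/2"
        using reals_Archimedean by (metis inverse_eq_divide)
      moreover have "1 / (real n + 2) \<le> 1 / real (Suc n)" by (simp add: field_simps)
      ultimately have "z \<in> D t n"
        using False less.prems(2) by (auto simp: D_def U_def)
      then have "z \<in> V t n" using Vp[OF less.prems(1)] by blast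
      moreover have "fst t \<inter> topspace X \<inter> X closure_of (V t n) = {}"
      proof -
        have ct: "continuous_map X euclideanreal (snd t)" "\<And>x. x \<in> fst t \<Longrightarrow> snd t x = 0"
          using less.prems(1) by (auto simp: T_def)
        have "X closure_of (V t n) \<subseteq> {x \<in> topspace X. 1/2 \<le> snd t x}"
        proof (rule closure_of_minimal)
          show "V t n \<subseteq> {x \<in> topspace X. 1/2 \<le> snd t x}"
            using Vp[OF less.prems(1), of n] unfolding U_def by force
        qed (rule closedin_superlevel[OF ct(1)])
        then show ?thesis using ct(2) by fastforce
      qed
      ultimately show ?thesis
        using V_\<E>[OF less.prems(1), of n] by (intro exI[of _ "{V t n}"]) auto
    qed
  qed
  show ?thesis
  proof (intro exI[of _ \<E>] conjI ballI)
    show "P_property P r (point_finite X) \<E>"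
      unfolding \<E>_def using E_mono E_pf by (intro P_property_of_double_index[OF dir ncd])
    show "cozero_set X G" if "G \<in> \<E>" for G
      using that Vp unfolding \<E>_def E_def by blast
    fix q A c z
    assume q: "q \<in> P" "A \<in> \<W> q" and c: "c \<in> A \<inter> topspace X" and z: "z \<in> topspace X - X closure_of A"
    have "closedin X {z}"
      using z haus by (simp add: Hausdorff_imp_t1_space closedin_t1_singleton)
    moreover have "openin X (topspace X - X closure_of A)"
      by (intro openin_diff openin_topspace closedin_closure_of)
    moreover have "{z} \<subseteq> topspace X - X closure_of A" using z by blast
    ultimately obtain f where f: "continuous_map X euclideanreal f" "f z = 1"
      "\<And>x. x \<in> topspace X - (topspace X - X closure_of A) \<Longrightarrow> f x = 0"
      using compact_Hausdorff_Urysohn[OF comp haus, of "{z}" "topspace X - X closure_of A"]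
      by blast
    \<comment> \<open>The sets of the families may leave the space, so \<open>f\<close> is set to \<open>0\<close> outside of it.\<close>
    define g where "g x = (if x \<in> topspace X then f x else 0)" for x
    have "continuous_map X euclideanreal g"
      using f(1) by (rule continuous_map_eq) (simp add: g_def)
    moreover have "g x = 0" if "x \<in> A" for x
      using f(3)[of x] that closure_of_subset_Int[of X A] by (auto simp: g_def)
    ultimately have "(A, g) \<in> T" using q by (auto simp: T_def)
    moreover have "z \<in> U (A, g)" using f(2) z by (simp add: U_def g_def)
    ultimately obtain \<V> where "\<V> \<subseteq> \<E>" "\<forall>V\<in>\<V>. z \<in> V"
      "A \<inter> topspace X \<inter> (\<Inter>V\<in>\<V>. X closure_of V) = {}"
      using sep[of "(A, g)" z] by auto
    moreover from this have "c \<notin> (\<Inter>V\<in>\<V>. X closure_of V)" using c by blast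
    then obtain V where "V \<in> \<V>" "c \<notin> X closure_of V" unfolding INT_iff by meson
    ultimately show "\<exists>V\<in>\<E>. z \<in> V \<and> c \<notin> X closure_of V" by (meson subsetD)
  qed
qed

section \<open>Gluing the local families along base points\<close>

definition finite_meets :: "'a topology \<Rightarrow> 'a set set \<Rightarrow> 'a set set" where
  "finite_meets X \<A> = {topspace X \<inter> \<Inter>\<S> | \<S>. finite \<S> \<and> \<S> \<subseteq> \<A>}"

definition base_point :: "'a set \<Rightarrow> 'a" where
  "base_point G = (SOME y. y \<in> G)"

lemma base_point_in: "z \<in> G \<Longrightarrow> base_point G \<in> G"
  unfolding base_point_def by (rule someI)

text \<open>\<open>E y\<close> is the family of sets to be used at \<open>y\<close>. It enters only through the base points of finite
intersections, and only inside these intersections; this restriction keeps the result point finite.\<close>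

primrec refinements :: "'a topology \<Rightarrow> ('a \<Rightarrow> 'a set set) \<Rightarrow> nat \<Rightarrow> 'a set set" where
  "refinements X E 0 = {}"
| "refinements X E (Suc n) = refinements X E n \<union>
     {V \<inter> G | V G. G \<in> finite_meets X (refinements X E n) \<and> G \<noteq> {} \<and> V \<in> E (base_point G)}"

lemma finite_meets_mono: "\<A> \<subseteq> \<B> \<Longrightarrow> finite_meets X \<A> \<subseteq> finite_meets X \<B>"
  unfolding finite_meets_def by blast

lemma finite_meets_subset_topspace: "G \<in> finite_meets X \<A> \<Longrightarrow> G \<subseteq> topspace X"
  unfolding finite_meets_def by blast

lemma base_point_in_topspace:
  assumes "G \<in> finite_meets X \<A>" "G \<noteq> {}"
  shows "base_point G \<in> topspace X"
proof -
  obtain z where "z \<in> G" using assms(2) by blast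
  then have "base_point G \<in> G" by (rule base_point_in)
  then show ?thesis using finite_meets_subset_topspace[OF assms(1)] by (rule rev_subsetD)
qed

lemma finite_meets_topspace: "topspace X \<in> finite_meets X \<A>"
  unfolding finite_meets_def by (intro CollectI exI[of _ "{}"]) simp

lemma finite_meets_Inter:
  assumes "finite \<G>" "\<G> \<subseteq> finite_meets X \<A>"
  shows "topspace X \<inter> \<Inter>\<G> \<in> finite_meets X \<A>"
  using assms
proof (induction \<G> rule: finite_induct)
  case (insert G \<G>)
  then obtain \<S> \<T> where "finite \<S>" "\<S> \<subseteq> \<A>" "G = topspace X \<inter> \<Inter>\<S>"
    "finite \<T>" "\<T> \<subseteq> \<A>" "topspace X \<inter> \<Inter>\<G> = topspace X \<inter> \<Inter>\<T>"
    by (auto simp: finite_meets_def)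
  moreover from this have "topspace X \<inter> \<Inter>(insert G \<G>) = topspace X \<inter> \<Inter>(\<S> \<union> \<T>)"
    by auto
  ultimately show ?case
    unfolding finite_meets_def by (intro CollectI exI[of _ "\<S> \<union> \<T>"]) simp
qed (simp add: finite_meets_topspace)

lemma refinements_mono_index:
  assumes "m \<le> n" shows "refinements X E m \<subseteq> refinements X E n"
  using assms by (induction n) (auto simp: le_Suc_eq)

lemma refinements_mono_family:
  assumes "\<And>y. y \<in> topspace X \<Longrightarrow> E y \<subseteq> E' y"
  shows "refinements X E n \<subseteq> refinements X E' n"
proof (induction n)
  case (Suc n)
  have "V \<inter> G \<in> refinements X E' (Suc n)"
    if G: "G \<in> finite_meets X (refinements X E n)" "G \<noteq> {}" and V: "V \<in> E (base_point G)" for V G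
  proof -
    have "base_point G \<in> topspace X"
      using G by (rule base_point_in_topspace)
    then have "V \<in> E' (base_point G)" using V assms by blast
    moreover have "G \<in> finite_meets X (refinements X E' n)"
      using G(1) finite_meets_mono[OF Suc.IH] by blast
    ultimately show ?thesis using G(2) by auto
  qed
  then show ?case using Suc.IH by auto
qed simp

lemma refinements_cozero:
  assumes "\<And>y V. y \<in> topspace X \<Longrightarrow> V \<in> E y \<Longrightarrow> cozero_set X V"
  shows "V \<in> refinements X E n \<Longrightarrow> cozero_set X V"
proof (induction n arbitrary: V)
  case (Suc n)
  have "cozero_set X (U \<inter> G)"
    if G: "G \<in> finite_meets X (refinements X E n)" "G \<noteq> {}" and U: "U \<in> E (base_point G)" for U G
  proof -
    have "base_point G \<in> topspace X"
      using G by (rule base_point_in_topspace)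
    moreover have "cozero_set X G"
      using G(1) Suc.IH cozero_set_finite_Inter unfolding finite_meets_def by blast
    ultimately show ?thesis using U assms cozero_set_Int by blast
  qed
  then show ?case using Suc by auto
qed simp

text \<open>A point \<open>z\<close> of \<open>V \<inter> G\<close> lies in each of the finitely many sets with intersection \<open>G\<close>; these are among
the finitely many sets of the previous round that contain \<open>z\<close>, which leaves finitely many \<open>G\<close>, and
hence finitely many base points.\<close>

lemma refinements_point_finite:
  assumes "\<And>y. y \<in> topspace X \<Longrightarrow> point_finite X (E y)"
  shows "point_finite X (refinements X E n)"
proof (induction n)
  case (Suc n)
  show ?case
    unfolding point_finite_def
  proof
    fix z assume z: "z \<in> topspace X"
    let ?A = "{V \<in> refinements X E n. z \<in> V}"
    have fin: "finite ?A" using Suc z by (simp add: point_finite_def)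
    let ?G = "(\<lambda>\<S>. topspace X \<inter> \<Inter>\<S>) ` Pow ?A"
    let ?F = "\<Union>G\<in>?G. (\<lambda>V. V \<inter> G) ` {V \<in> E (base_point G). z \<in> V}"
    have "finite ?F"
    proof (intro finite_UN_I finite_imageI)
      show "finite (Pow ?A)" using fin by simp
      fix G assume "G \<in> ?G"
      then have "z \<in> G" "G \<subseteq> topspace X" using z by auto
      then have "base_point G \<in> topspace X" using base_point_in[of z G] by (meson subsetD)
      then show "finite {V \<in> E (base_point G). z \<in> V}"
        using assms z by (simp add: point_finite_def)
    qed
    moreover have "{V \<in> refinements X E (Suc n). z \<in> V} \<subseteq> ?A \<union> ?F"
    proof
      fix U assume "U \<in> {V \<in> refinements X E (Suc n). z \<in> V}"
      then consider "U \<in> ?A" | V G where "U = V \<inter> G" "G \<in> finite_meets X (refinements X E n)"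
        "V \<in> E (base_point G)" "z \<in> V" "z \<in> G"
        by auto
      then show "U \<in> ?A \<union> ?F"
      proof cases
        case 2
        then obtain \<S> where "\<S> \<subseteq> refinements X E n" "G = topspace X \<inter> \<Inter>\<S>"
          by (auto simp: finite_meets_def)
        with 2 have "G \<in> ?G" by blast
        with 2 show ?thesis by blast
      qed blast
    qed
    ultimately show "finite {V \<in> refinements X E (Suc n). z \<in> V}"
      using fin by (meson finite_UnI finite_subset)
  qed
qed (simp add: point_finite_def)

text \<open>The finite intersections that contain \<open>z\<close> are directed by reverse inclusion, and the base points
form a net on them. The proof takes a cluster point \<open>c\<close> of the part of the net outside \<open>U\<close>. The network
condition at \<open>c\<close>, applied to a neighbourhood of \<open>c\<close> whose closure misses \<open>z\<close>, holds at some base point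
near \<open>c\<close>, and the hypothesis \<open>refine\<close> at this base point yields an intersection \<open>V' \<inter> G\<close> below which
no base point is near \<open>c\<close>.\<close>

lemma base_points_converge:
  assumes comp: "compact_space X" and haus: "Hausdorff_space X"
    and net: "P_point_network P r Q X N"
    and refine: "\<And>G p A c. G \<in> finite_meets X \<alpha> \<Longrightarrow> z \<in> G \<Longrightarrow> p \<in> P \<Longrightarrow> A \<in> N p (base_point G) \<Longrightarrow>
      z \<notin> X closure_of A \<Longrightarrow> c \<in> A \<inter> topspace X \<Longrightarrow>
      \<exists>V. z \<in> V \<and> c \<notin> X closure_of V \<and> V \<inter> G \<in> \<alpha>"
    and z: "z \<in> U" and U: "openin X U"
  shows "\<exists>G\<in>finite_meets X \<alpha>. z \<in> G \<and>
    (\<forall>G'\<in>finite_meets X \<alpha>. z \<in> G' \<and> G' \<subseteq> G \<longrightarrow> base_point G' \<in> U)"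
proof (rule ccontr)
  let ?M = "{G \<in> finite_meets X \<alpha>. z \<in> G}"
  assume "\<not> ?thesis"
  then have esc: "\<exists>G'\<in>?M. G' \<subseteq> G \<and> base_point G' \<notin> U" if "G \<in> ?M" for G
    using that by blast
  have zX: "z \<in> topspace X" using z U openin_subset by blast
  have bp: "base_point G \<in> G" "base_point G \<in> topspace X" if "G \<in> ?M" for G
    using that base_point_in[of z G] finite_meets_subset_topspace[of G X \<alpha>] by auto
  define B where "B G = {base_point G' | G'. G' \<in> ?M \<and> G' \<subseteq> G \<and> base_point G' \<notin> U}" for G
  have B_top: "B G \<subseteq> topspace X" for G unfolding B_def using bp(2) by blast
  let ?K = "(\<lambda>G. X closure_of B G) ` ?M"
  have "\<Inter>?K \<noteq> {}"
  proof (rule comp[unfolded compact_space_fip, rule_format], intro conjI allI impI ballI)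
    show "closedin X C" if "C \<in> ?K" for C using that by auto
    fix \<F> assume "finite \<F> \<and> \<F> \<subseteq> ?K"
    then obtain \<G> where \<G>: "finite \<G>" "\<G> \<subseteq> ?M" "\<F> = (\<lambda>G. X closure_of B G) ` \<G>"
      by (meson finite_subset_image)
    have "topspace X \<inter> \<Inter>\<G> \<in> ?M"
      using finite_meets_Inter[OF \<G>(1), of X \<alpha>] \<G>(2) zX by blast
    then obtain G' where G': "G' \<in> ?M" "G' \<subseteq> topspace X \<inter> \<Inter>\<G>" "base_point G' \<notin> U"
      using esc by blast
    have "base_point G' \<in> X closure_of B G" if "G \<in> \<G>" for G
    proof -
      have "base_point G' \<in> B G" unfolding B_def using G' that by blast
      then show ?thesis using closure_of_subset[OF B_top] by blast
    qed
    then show "\<Inter>\<F> \<noteq> {}" unfolding \<G>(3) by blast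
  qed
  then obtain c where c_in: "c \<in> \<Inter>?K"
    unfolding ex_in_conv[symmetric] by (rule exE)
  have c: "c \<in> X closure_of B G" if "G \<in> ?M" for G
    using c_in that by blast
  have cX: "c \<in> topspace X" and cU: "c \<notin> U"
  proof -
    have "topspace X \<in> ?M" using finite_meets_topspace zX by blast
    then have "c \<in> X closure_of B (topspace X)" by (rule c)
    moreover have "X closure_of B (topspace X) \<subseteq> topspace X - U"
      by (rule closure_of_minimal) (use B_top U in \<open>auto simp: B_def\<close>)
    ultimately show "c \<in> topspace X" "c \<notin> U" by blast+
  qed
  obtain Uc Uz where Uc: "openin X Uc" "c \<in> Uc" and Uz: "openin X Uz" "z \<in> Uz" and disj: "disjnt Uc Uz"
    using haus cX zX cU z unfolding Hausdorff_space_def by metis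
  obtain V p where V: "openin X V" "c \<in> V" "p \<in> P" "\<forall>y\<in>V. \<exists>A\<in>N p y. c \<in> A \<and> A \<subseteq> Uc"
    using net Uc unfolding P_point_network_def by meson
  have "topspace X \<in> ?M" using finite_meets_topspace zX by blast
  from c[OF this] V(1,2) have "\<exists>y. y \<in> B (topspace X) \<and> y \<in> V"
    unfolding in_closure_of by blast
  then obtain G where G: "G \<in> ?M" "base_point G \<in> V" unfolding B_def by blast
  then obtain A where A: "A \<in> N p (base_point G)" "c \<in> A" "A \<subseteq> Uc" using V(4) by blast
  have "z \<notin> X closure_of A"
    using Uz disj A(3) unfolding in_closure_of disjnt_def by blast
  then obtain V' where V': "z \<in> V'" "c \<notin> X closure_of V'" "V' \<inter> G \<in> \<alpha>"
    using refine[of G p A c] G(1) V(3) A cX by blast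
  have "V' \<inter> G \<in> finite_meets X \<alpha>"
  proof -
    have "V' \<inter> G = topspace X \<inter> \<Inter>{V' \<inter> G}"
      using G(1) finite_meets_subset_topspace by blast
    then show ?thesis using V'(3) unfolding finite_meets_def by blast
  qed
  then have "V' \<inter> G \<in> ?M" using V'(1) G(1) by blast
  then have "c \<in> X closure_of B (V' \<inter> G)" by (rule c)
  moreover have "B (V' \<inter> G) \<subseteq> V'" unfolding B_def using bp(1) by blast
  ultimately show False using V'(2) closure_of_mono by blast
qed

text \<open>Points that lie in the same members of the family have the same finite intersections around them,
hence the same net of base points, and limits in a Hausdorff space are unique.\<close>

lemma point_finite_T0_separating_cozero_family:
  fixes X :: "'a topology" and P :: "'p set"
  assumes dir: "directed_set P r" and ncd: "\<not> countably_directed P r"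
    and comp: "compact_space X" and haus: "Hausdorff_space X"
    and net: "P_point_network P r additively_Noetherian X N"
  shows "\<exists>\<alpha>. P_property P r (point_finite X) \<alpha> \<and> (\<forall>V\<in>\<alpha>. cozero_set X V) \<and>
    (\<forall>x\<in>topspace X. \<forall>y\<in>topspace X. x \<noteq> y \<longrightarrow> (\<exists>V\<in>\<alpha>. x \<in> V \<longleftrightarrow> y \<notin> V))"
proof -
  have "\<exists>E. (\<forall>p\<in>P. \<forall>q\<in>P. (p, q) \<in> r \<longrightarrow> E p \<subseteq> E q) \<and>
      (\<forall>p\<in>P. point_finite X (E p) \<and> (\<forall>V\<in>E p. cozero_set X V)) \<and>
      (\<forall>p\<in>P. \<forall>A\<in>N p y. \<forall>c\<in>A \<inter> topspace X. \<forall>z\<in>topspace X - X closure_of A.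
        \<exists>q\<in>P. \<exists>V\<in>E q. z \<in> V \<and> c \<notin> X closure_of V)"
    if y: "y \<in> topspace X" for y
  proof -
    have N_mono: "N p y \<subseteq> N q y" if "p \<in> P" "q \<in> P" "(p, q) \<in> r" for p q
      using net y that unfolding P_point_network_def P_pointed_family_def by blast
    have N_Noeth: "additively_Noetherian (N p y)" if "p \<in> P" for p
      using net y that unfolding P_point_network_def P_pointed_family_def by blast
    have "\<exists>\<E>. P_property P r (point_finite X) \<E> \<and> (\<forall>V\<in>\<E>. cozero_set X V) \<and>
      (\<forall>p\<in>P. \<forall>A\<in>N p y. \<forall>c\<in>A \<inter> topspace X. \<forall>z\<in>topspace X - X closure_of A.
        \<exists>V\<in>\<E>. z \<in> V \<and> c \<notin> X closure_of V)"
      by (rule point_finite_family_separating_from_Noetherian_families[OF dir ncd comp haus net])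
        (fact N_mono N_Noeth)+
    then obtain \<E> where \<E>: "P_property P r (point_finite X) \<E>" "\<forall>V\<in>\<E>. cozero_set X V"
      "\<forall>p\<in>P. \<forall>A\<in>N p y. \<forall>c\<in>A \<inter> topspace X. \<forall>z\<in>topspace X - X closure_of A.
        \<exists>V\<in>\<E>. z \<in> V \<and> c \<notin> X closure_of V"
      by (elim exE conjE) (rule that)
    from \<E>(1) obtain E where E: "\<E> = (\<Union>p\<in>P. E p)" "\<forall>p\<in>P. point_finite X (E p)"
      "\<forall>p\<in>P. \<forall>q\<in>P. (p, q) \<in> r \<longrightarrow> E p \<subseteq> E q"
      unfolding P_property_def ordered_as_def by blast
    show ?thesis
    proof (intro exI[of _ E] conjI)
      show "\<forall>p\<in>P. point_finite X (E p) \<and> (\<forall>V\<in>E p. cozero_set X V)"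
        using E(1,2) \<E>(2) by blast
      show "\<forall>p\<in>P. \<forall>A\<in>N p y. \<forall>c\<in>A \<inter> topspace X. \<forall>z\<in>topspace X - X closure_of A.
          \<exists>q\<in>P. \<exists>V\<in>E q. z \<in> V \<and> c \<notin> X closure_of V"
      proof (intro ballI)
        fix p A c z
        assume "p \<in> P" "A \<in> N p y" "c \<in> A \<inter> topspace X" "z \<in> topspace X - X closure_of A"
        then obtain V where "V \<in> \<E>" "z \<in> V" "c \<notin> X closure_of V" using \<E>(3) by metis
        then show "\<exists>q\<in>P. \<exists>V\<in>E q. z \<in> V \<and> c \<notin> X closure_of V" unfolding E(1) by blast
      qed
    qed (fact E(3))
  qed
  then have "\<forall>y\<in>topspace X. \<exists>E. (\<forall>p\<in>P. \<forall>q\<in>P. (p, q) \<in> r \<longrightarrow> E p \<subseteq> E q) \<and>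
      (\<forall>p\<in>P. point_finite X (E p) \<and> (\<forall>V\<in>E p. cozero_set X V)) \<and>
      (\<forall>p\<in>P. \<forall>A\<in>N p y. \<forall>c\<in>A \<inter> topspace X. \<forall>z\<in>topspace X - X closure_of A.
        \<exists>q\<in>P. \<exists>V\<in>E q. z \<in> V \<and> c \<notin> X closure_of V)" ..
  from bchoice[OF this] obtain E where
    E: "\<forall>y\<in>topspace X. (\<forall>p\<in>P. \<forall>q\<in>P. (p, q) \<in> r \<longrightarrow> E y p \<subseteq> E y q) \<and>
      (\<forall>p\<in>P. point_finite X (E y p) \<and> (\<forall>V\<in>E y p. cozero_set X V)) \<and>
      (\<forall>p\<in>P. \<forall>A\<in>N p y. \<forall>c\<in>A \<inter> topspace X. \<forall>z\<in>topspace X - X closure_of A.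
        \<exists>q\<in>P. \<exists>V\<in>E y q. z \<in> V \<and> c \<notin> X closure_of V)"
    by (rule exE)
  have E_mono: "E y p \<subseteq> E y q" if "y \<in> topspace X" "p \<in> P" "q \<in> P" "(p, q) \<in> r" for y p q
    using bspec[OF E that(1)] that by blast
  have E_pf: "point_finite X (E y p)" if "y \<in> topspace X" "p \<in> P" for y p
    using bspec[OF E that(1)] that by blast
  have E_coz: "cozero_set X V" if "y \<in> topspace X" "p \<in> P" "V \<in> E y p" for y p V
    using bspec[OF E that(1)] that by blast
  have E_sep: "\<exists>q\<in>P. \<exists>V\<in>E y q. z \<in> V \<and> c \<notin> X closure_of V"
    if "y \<in> topspace X" "p \<in> P" "A \<in> N p y" "c \<in> A \<inter> topspace X" "z \<in> topspace X - X closure_of A"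
    for y p A c z
    using bspec[OF E that(1)] that by meson
  define F where "F n p = refinements X (\<lambda>y. E y p) n" for n p
  define \<alpha> where "\<alpha> = (\<Union>n. \<Union>p\<in>P. F n p)"
  have F_mono: "F m p \<subseteq> F n q" if "m \<le> n" "p \<in> P" "q \<in> P" "(p, q) \<in> r" for m n p q
  proof -
    have "F m p \<subseteq> F n p" unfolding F_def using that(1) by (rule refinements_mono_index)
    also have "\<dots> \<subseteq> F n q"
      unfolding F_def by (rule refinements_mono_family) (use that E_mono in blast)
    finally show ?thesis .
  qed
  have \<alpha>_refine: "V \<inter> G \<in> \<alpha>"
    if G: "G \<in> finite_meets X \<alpha>" "G \<noteq> {}" and V: "q \<in> P" "V \<in> E (base_point G) q" for V G q
  proof -
    obtain \<S> where \<S>: "finite \<S>" "\<S> \<subseteq> \<alpha>" "G = topspace X \<inter> \<Inter>\<S>"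
      using G(1) unfolding finite_meets_def by blast
    obtain n u where u: "u \<in> P" "(q, u) \<in> r" "\<S> \<subseteq> F n u"
      using finite_subset_of_double_index[OF dir F_mono \<S>(1) \<S>(2)[unfolded \<alpha>_def] V(1)] by blast
    have "G \<in> finite_meets X (F n u)"
      using \<S> u(3) unfolding finite_meets_def by blast
    moreover have "V \<in> E (base_point G) u"
    proof -
      have "base_point G \<in> topspace X"
        using G by (rule base_point_in_topspace)
      then show ?thesis using E_mono V u by blast
    qed
    ultimately have "V \<inter> G \<in> F (Suc n) u"
      using G(2) unfolding F_def by auto
    then show ?thesis unfolding \<alpha>_def using u(1) by blast
  qed
  have conv: "\<exists>G\<in>finite_meets X \<alpha>. z \<in> G \<and>
      (\<forall>G'\<in>finite_meets X \<alpha>. z \<in> G' \<and> G' \<subseteq> G \<longrightarrow> base_point G' \<in> U)"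
    if "z \<in> U" "openin X U" for z U
  proof (rule base_points_converge[OF comp haus net _ that])
    fix G p A c
    assume G: "G \<in> finite_meets X \<alpha>" "z \<in> G" and A: "p \<in> P" "A \<in> N p (base_point G)"
      "z \<notin> X closure_of A" "c \<in> A \<inter> topspace X"
    have "base_point G \<in> topspace X"
      using base_point_in_topspace[OF G(1)] G(2) by blast
    moreover have "z \<in> topspace X - X closure_of A"
      using A(3) G finite_meets_subset_topspace by blast
    ultimately obtain q V where "q \<in> P" "V \<in> E (base_point G) q" "z \<in> V" "c \<notin> X closure_of V"
      using E_sep A by metis
    then show "\<exists>V. z \<in> V \<and> c \<notin> X closure_of V \<and> V \<inter> G \<in> \<alpha>"
      using \<alpha>_refine G by blast
  qed
  have sep: "\<exists>V\<in>\<alpha>. x \<in> V \<longleftrightarrow> y \<notin> V"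
    if xy: "x \<in> topspace X" "y \<in> topspace X" "x \<noteq> y" for x y
  proof (rule ccontr)
    assume "\<not> ?thesis"
    then have "\<And>V. V \<in> \<alpha> \<Longrightarrow> x \<in> V \<longleftrightarrow> y \<in> V" by blast
    then have same: "x \<in> G \<longleftrightarrow> y \<in> G" if "G \<in> finite_meets X \<alpha>" for G
      using that xy(1,2) unfolding finite_meets_def by auto
    obtain U V where UV: "openin X U" "x \<in> U" "openin X V" "y \<in> V" "disjnt U V"
      using haus xy unfolding Hausdorff_space_def by metis
    obtain G where G: "G \<in> finite_meets X \<alpha>" "x \<in> G"
      "\<forall>G'\<in>finite_meets X \<alpha>. x \<in> G' \<and> G' \<subseteq> G \<longrightarrow> base_point G' \<in> U"
      using conv[OF UV(2,1)] by blast
    obtain H where H: "H \<in> finite_meets X \<alpha>" "y \<in> H"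
      "\<forall>G'\<in>finite_meets X \<alpha>. y \<in> G' \<and> G' \<subseteq> H \<longrightarrow> base_point G' \<in> V"
      using conv[OF UV(4,3)] by blast
    have "G \<inter> H = topspace X \<inter> \<Inter>{G, H}" using finite_meets_subset_topspace[OF G(1)] by auto
    also have "\<dots> \<in> finite_meets X \<alpha>" using G(1) H(1) by (intro finite_meets_Inter) auto
    finally have GH: "G \<inter> H \<in> finite_meets X \<alpha>" .
    have "x \<in> G \<inter> H" "y \<in> G \<inter> H" using G(1,2) H(1,2) same by blast+
    then have "base_point (G \<inter> H) \<in> U" "base_point (G \<inter> H) \<in> V"
      using bspec[OF G(3) GH] bspec[OF H(3) GH] by auto
    then show False using UV(5) by (meson disjnt_iff)
  qed
  have pf: "P_property P r (point_finite X) \<alpha>"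
    unfolding \<alpha>_def
  proof (rule P_property_of_double_index[OF dir ncd F_mono])
    show "point_finite X (F n p)" if "p \<in> P" for n p
      unfolding F_def using that E_pf by (intro refinements_point_finite)
  qed
  have coz: "cozero_set X V" if "V \<in> \<alpha>" for V
  proof -
    obtain n p where "p \<in> P" "V \<in> refinements X (\<lambda>y. E y p) n"
      using \<open>V \<in> \<alpha>\<close> unfolding \<alpha>_def F_def by blast
    then show ?thesis
      using refinements_cozero[of X "\<lambda>y. E y p" V n] E_coz by blast
  qed
  show ?thesis
    by (intro exI[of _ \<alpha>] conjI ballI impI) (fact pf coz sep)+
qed

section \<open>Almost subbases from separating functions\<close>

lemma U_representation_mono:
  assumes "U_representation X V U" "1 \<le> m" "m \<le> n"
  shows "U m \<subseteq> U n"
  using assms(3,2)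
proof (induction n rule: dec_induct)
  case (step n)
  then have "U n \<subseteq> U (Suc n)"
    using assms(1) unfolding U_representation_def by auto
  then show ?case using step by blast
qed simp

lemma U_representation_subset:
  assumes "U_representation X V U" "1 \<le> n"
  shows "U n \<subseteq> V"
proof -
  have "V = (\<Union>n\<in>{1..}. U n)" using assms(1) unfolding U_representation_def by blast
  moreover have "n \<in> {1..}" using assms(2) by simp
  ultimately show ?thesis by blast
qed

lemma U_representation_mem_even:
  assumes rep: "U_representation X V U" and "x \<in> V"
  obtains n where "1 \<le> n" "x \<in> U (2 * n)"
proof -
  have "V = (\<Union>n\<in>{1..}. U n)" using rep unfolding U_representation_def by blast
  then have "x \<in> (\<Union>n\<in>{1..}. U n)" using assms(2) by simp
  then obtain n where n: "1 \<le> n" "x \<in> U n" by auto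
  then have "x \<in> U (2 * n)" using U_representation_mono[OF rep, of n "2 * n"] by auto
  with n(1) show ?thesis by (rule that)
qed

lemma U_representation_openin:
  assumes rep: "U_representation X V U"
  shows "openin X V"
proof (subst openin_subopen, intro ballI)
  fix x assume "x \<in> V"
  then obtain n where n: "1 \<le> n" "x \<in> U (2 * n)" by (rule U_representation_mem_even[OF rep])
  moreover have "openin X (U (2 * n))"
    using rep n(1) cozero_set_imp_openin[of X] unfolding U_representation_def by blast
  moreover have "U (2 * n) \<subseteq> V" using n(1) by (intro U_representation_subset[OF rep]) simp
  ultimately show "\<exists>T. openin X T \<and> x \<in> T \<and> T \<subseteq> V" by blast
qed

text \<open>The sets with even index form an increasing open cover of \<open>V\<close>, and each of them is contained in the
next set with odd index.\<close>

lemma U_representation_compact_subset: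
  assumes rep: "U_representation X V U" and C: "compactin X C" "C \<subseteq> V"
  shows "\<exists>n\<ge>1. C \<subseteq> U (2 * n - 1)"
proof -
  have coz: "cozero_set X (U (2 * n))" if "1 \<le> n" for n
    using rep that unfolding U_representation_def by auto
  have "C \<subseteq> \<Union>((\<lambda>n. U (2 * n)) ` {1..})"
  proof
    fix x assume "x \<in> C"
    then have "x \<in> V" using C(2) by blast
    then obtain n where "1 \<le> n" "x \<in> U (2 * n)" by (rule U_representation_mem_even[OF rep])
    then show "x \<in> \<Union>((\<lambda>n. U (2 * n)) ` {1..})" by auto
  qed
  moreover have "\<forall>G\<in>(\<lambda>n. U (2 * n)) ` {1..}. openin X G"
    using coz cozero_set_imp_openin by auto
  ultimately obtain \<F> where "finite \<F>" "\<F> \<subseteq> (\<lambda>n. U (2 * n)) ` {1..}" "C \<subseteq> \<Union>\<F>"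
    using C(1) unfolding compactin_def by meson
  then obtain I where I: "finite I" "I \<subseteq> {1..}" "C \<subseteq> (\<Union>n\<in>I. U (2 * n))"
    by (metis finite_subset_image)
  define m where "m = Max (insert 1 I)"
  have m: "1 \<le> m" "\<And>n. n \<in> I \<Longrightarrow> n \<le> m" unfolding m_def using I(1) by auto
  have "C \<subseteq> U (2 * (m + 1) - 1)"
  proof
    fix x assume "x \<in> C"
    then obtain n where n: "n \<in> I" "x \<in> U (2 * n)" using I(3) by blast
    have "U (2 * n) \<subseteq> U (2 * (m + 1) - 1)"
      using U_representation_mono[OF rep, of "2 * n" "2 * (m + 1) - 1"] I(2) m(2)[OF n(1)] n(1) by auto
    then show "x \<in> U (2 * (m + 1) - 1)" using n(2) by blast
  qed
  then show ?thesis by (intro exI[of _ "m + 1"]) simp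
qed

text \<open>It does not matter which \<open>U\<close>-representations are chosen: by compactness some \<open>U\<^bsub>2n-1\<^esub>(V)\<close> contains
\<open>C\<close>, so \<open>V'\<close> and the complement of \<open>U\<^bsub>2n-1\<^esub>(V)\<close> are disjoint members of the subbase. Therefore the
topology generated is Hausdorff, and a compact topology has no strictly coarser Hausdorff topology.
This independence is essential, since different functions may define the same set \<open>V\<close>, to which only
one representation is attached.\<close>

lemma almost_subbase_of_separating_family:
  assumes comp: "compact_space X" and haus: "Hausdorff_space X"
    and rep: "\<And>V. V \<in> \<alpha> \<Longrightarrow> \<exists>U. U_representation X V U"
    and sep: "\<And>x y. x \<in> topspace X \<Longrightarrow> y \<in> topspace X \<Longrightarrow> x \<noteq> y \<Longrightarrow>
      \<exists>V\<in>\<alpha>. \<exists>V'\<in>\<alpha>. \<exists>C. closedin X C \<and> V' \<subseteq> C \<and> C \<subseteq> V \<and> (x \<in> V' \<and> y \<notin> V \<or> y \<in> V' \<and> x \<notin> V)"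
  shows "almost_subbase X \<alpha>"
proof -
  have "\<forall>V\<in>\<alpha>. \<exists>U. U_representation X V U" using rep by blast
  from bchoice[OF this] obtain U where U: "\<forall>V\<in>\<alpha>. U_representation X V (U V)" by (rule exE)
  have opn: "openin X V" if "V \<in> \<alpha>" for V
    using rep[OF that] U_representation_openin by blast
  define \<S> where "\<S> = \<alpha> \<union> {topspace X - U V (2 * n - 1) | V n. V \<in> \<alpha> \<and> n \<ge> 1}"
  have open_\<S>: "openin X S" if "S \<in> \<S>" for S
  proof -
    have "closedin X (U V (2 * n - 1))" if "V \<in> \<alpha>" "n \<ge> 1" for V n
    proof (rule zero_set_imp_closedin)
      show "zero_set X (U V (2 * n - 1))"
        using bspec[OF U that(1)] that(2) unfolding U_representation_def by blast
    qed
    then show ?thesis using that opn unfolding \<S>_def by blast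
  qed
  define Y where "Y = topology (arbitrary union_of (finite intersection_of (\<lambda>A. A \<in> \<S>) relative_to topspace X))"
  have open_Y: "openin Y = arbitrary union_of (finite intersection_of (\<lambda>A. A \<in> \<S>) relative_to topspace X)"
    unfolding Y_def by (rule ext) (rule openin_subbase)
  have top_Y: "topspace Y = topspace X" unfolding Y_def by simp
  have YX: "openin X G" if "openin Y G" for G
    using minimal_topology_subbase[of "\<lambda>A. A \<in> \<S>" X "topspace X" G] open_\<S> that
    unfolding Y_def by blast
  have \<S>_Y: "openin Y S" if "S \<in> \<S>" for S
  proof -
    have "(finite intersection_of (\<lambda>A. A \<in> \<S>) relative_to topspace X) (topspace X \<inter> S)"
      using that by (intro relative_to_inc finite_intersection_of_inc)
    moreover have "topspace X \<inter> S = S" using openin_subset[OF open_\<S>[OF that]] by blast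
    ultimately show ?thesis unfolding open_Y by (simp add: arbitrary_union_of_inc)
  qed
  have sepY: "\<exists>G H. openin Y G \<and> openin Y H \<and> x \<in> G \<and> y \<in> H \<and> disjnt G H"
    if y: "y \<in> topspace X" and V: "V \<in> \<alpha>" "V' \<in> \<alpha>" "closedin X C" "V' \<subseteq> C" "C \<subseteq> V" "x \<in> V'" "y \<notin> V"
    for x y V V' C
  proof -
    have "compactin X C" using comp V(3) by (rule closedin_compact_space)
    moreover have repV: "U_representation X V (U V)" using U V(1) by blast
    ultimately obtain n where n: "n \<ge> 1" "C \<subseteq> U V (2 * n - 1)"
      using U_representation_compact_subset V(5) by metis
    have "U V (2 * n - 1) \<subseteq> V"
      using n(1) by (intro U_representation_subset[OF repV]) simp
    then have "y \<in> topspace X - U V (2 * n - 1)" using y V(7) by blast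
    moreover have "openin Y (topspace X - U V (2 * n - 1))"
      using \<S>_Y n(1) V(1) unfolding \<S>_def by blast
    moreover have "openin Y V'" using \<S>_Y V(2) unfolding \<S>_def by blast
    moreover have "disjnt V' (topspace X - U V (2 * n - 1))"
      using V(4) n(2) by (auto simp: disjnt_def)
    ultimately show ?thesis using V(6) by blast
  qed
  have "Hausdorff_space Y"
    unfolding Hausdorff_space_def top_Y
  proof (intro allI impI)
    fix x y assume xy: "x \<in> topspace X \<and> y \<in> topspace X \<and> x \<noteq> y"
    then obtain V V' C where V: "V \<in> \<alpha>" "V' \<in> \<alpha>" "closedin X C" "V' \<subseteq> C" "C \<subseteq> V"
      "x \<in> V' \<and> y \<notin> V \<or> y \<in> V' \<and> x \<notin> V"
      using sep by metis
    from V(6) show "\<exists>G H. openin Y G \<and> openin Y H \<and> x \<in> G \<and> y \<in> H \<and> disjnt G H"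
    proof
      assume "x \<in> V' \<and> y \<notin> V"
      then show ?thesis using sepY[of y V V' C x] V xy by blast
    next
      assume "y \<in> V' \<and> x \<notin> V"
      then obtain G H where "openin Y G" "openin Y H" "y \<in> G" "x \<in> H" "disjnt G H"
        using sepY[of x V V' C y] V xy by blast
      then show ?thesis using disjnt_sym by blast
    qed
  qed
  moreover have "continuous_map X Y id"
    unfolding continuous_map_def
  proof (intro conjI allI impI)
    fix G assume "openin Y G"
    moreover from this have "{x \<in> topspace X. id x \<in> G} = G"
      using openin_subset top_Y by fastforce
    ultimately show "openin X {x \<in> topspace X. id x \<in> G}" using YX by simp
  qed (simp add: top_Y)
  ultimately have "homeomorphic_map X Y id"
    using comp top_Y by (intro continuous_imp_homeomorphic_map) auto
  then have "Y = X" by simp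
  then have "subbase_of X \<S>"
    using open_Y openin_subset[OF open_\<S>] unfolding subbase_of_def by simp
  then show ?thesis
    unfolding almost_subbase_def \<S>_def using U openin_subset[OF opn] by blast
qed

lemma U_representation_superlevel:
  fixes g :: "'a \<Rightarrow> real"
  assumes g: "continuous_map X euclideanreal g"
  shows "\<exists>U. U_representation X {x \<in> topspace X. t < g x} U"
proof -
  define U where "U n = (if odd n then {x \<in> topspace X. t + 1 / real (n + 1) \<le> g x}
    else {x \<in> topspace X. t + 1 / real (n + 1) < g x})" for n
  have dec: "1 / real (n + 1 + 1) < 1 / real (n + 1)" for n by (simp add: field_simps)
  have "U_representation X {x \<in> topspace X. t < g x} U"
    unfolding U_representation_def
  proof (intro conjI allI impI)
    show "{x \<in> topspace X. t < g x} = (\<Union>n\<in>{1..}. U n)"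
    proof (intro subset_antisym subsetI)
      fix x assume x: "x \<in> {x \<in> topspace X. t < g x}"
      then have "0 < g x - t" by simp
      then obtain n where "1 / real (Suc n) < g x - t"
        using reals_Archimedean by (metis inverse_eq_divide)
      then have "1 / real (n + 1 + 1) < g x - t" using dec[of n] by simp
      then have "x \<in> U (n + 1)" unfolding U_def using x by simp
      then show "x \<in> (\<Union>n\<in>{1..}. U n)" by (intro UN_I[of "n + 1"]) auto
    next
      fix x assume "x \<in> (\<Union>n\<in>{1..}. U n)"
      then obtain n where "x \<in> U n" by blast
      then have "x \<in> topspace X" "t + 1 / real (n + 1) \<le> g x"
        unfolding U_def by (auto split: if_splits)
      moreover have "t < t + 1 / real (n + 1)" by simp
      ultimately show "x \<in> {x \<in> topspace X. t < g x}" using less_le_trans by blast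
    qed
    fix n :: nat assume n: "1 \<le> n"
    show "U n \<subseteq> U (n + 1)"
    proof
      fix x assume "x \<in> U n"
      then have "x \<in> topspace X" "t + 1 / real (n + 1) \<le> g x"
        unfolding U_def by (auto split: if_splits)
      then show "x \<in> U (n + 1)" unfolding U_def using dec[of n] by auto
    qed
    show "zero_set X (U (2 * n - 1))" "cozero_set X (U (2 * n))"
      unfolding U_def using n zero_setI_superlevel[OF g] cozero_setI_superlevel[OF g] by auto
  qed
  then show ?thesis by blast
qed

lemma rational_between:
  fixes a b :: real
  assumes "0 \<le> a" "a < b"
  obtains m k :: nat where "a < real (m + 1) / real (k + 1)" "real (m + 1) / real (k + 1) < b"
proof -
  obtain q where q: "a < real_of_rat q" "real_of_rat q < b" using of_rat_dense[OF assms(2)] by blast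
  then have pos: "0 < q" using assms(1) by (metis le_less_trans of_rat_0 of_rat_less)
  obtain i j where ij: "quotient_of q = (i, j)" by force
  then have j: "0 < j" and qij: "q = of_int i / of_int j"
    using quotient_of_denom_pos quotient_of_div by blast+
  then have i: "0 < i" using pos by (simp add: zero_less_divide_iff)
  have "real (nat (i - 1) + 1) = real_of_int i" "real (nat (j - 1) + 1) = real_of_int j"
    using i j by auto
  moreover have "real_of_rat q = real_of_int i / real_of_int j"
    unfolding qij by (simp add: of_rat_divide)
  ultimately show ?thesis using that[of "nat (i - 1)" "nat (j - 1)"] q by simp
qed

text \<open>The almost subbase consists of the superlevel sets \<open>{g\<^sub>i > t}\<close> for rational \<open>t > 0\<close>. Two thresholds
\<open>t < t'\<close> between \<open>g\<^sub>i(y)\<close> and \<open>g\<^sub>i(x)\<close> provide the sets \<open>V' \<subseteq> C \<subseteq> V\<close> needed above. Positive thresholds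
turn the vanishing of \<open>g\<^sub>i(x)\<close> along \<open>Ip p\<close> into point finiteness.\<close>

lemma almost_subbase_of_functions:
  fixes X :: "'a topology" and g :: "'i \<Rightarrow> 'a \<Rightarrow> real"
  assumes dir: "directed_set P r" and ncd: "\<not> countably_directed P r"
    and comp: "compact_space X" and haus: "Hausdorff_space X"
    and ord: "ordered_as P r Ip I"
    and cont: "\<And>i. i \<in> I \<Longrightarrow> continuous_map X euclideanreal (g i)"
    and nonneg: "\<And>i x. i \<in> I \<Longrightarrow> x \<in> topspace X \<Longrightarrow> 0 \<le> g i x"
    and fin: "\<And>p x e. p \<in> P \<Longrightarrow> x \<in> topspace X \<Longrightarrow> 0 < e \<Longrightarrow> finite {i \<in> Ip p. e < g i x}"
    and sep: "\<And>x y. x \<in> topspace X \<Longrightarrow> y \<in> topspace X \<Longrightarrow> x \<noteq> y \<Longrightarrow> \<exists>i\<in>I. g i x \<noteq> g i y"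
  shows "\<exists>\<alpha>. almost_subbase X \<alpha> \<and> P_property P r (point_finite X) \<alpha>"
proof -
  define t where "t m k = real (m + 1) / real (k + 1)" for m k :: nat
  define V where "V i m k = {x \<in> topspace X. t m k < g i x}" for i m k
  define Cf where "Cf n p = {V i m k | i m k. i \<in> Ip p \<and> m \<le> n \<and> k \<le> n}" for n p
  define \<alpha> where "\<alpha> = (\<Union>n. \<Union>p\<in>P. Cf n p)"
  have Ip_mono: "Ip p \<subseteq> Ip q" if "p \<in> P" "q \<in> P" "(p, q) \<in> r" for p q
    using ord that unfolding ordered_as_def by auto
  have I_eq: "I = (\<Union>p\<in>P. Ip p)" using ord unfolding ordered_as_def by blast
  have V_\<alpha>: "V i m k \<in> \<alpha>" if i: "i \<in> I" for i m k
  proof -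
    obtain p where "p \<in> P" "i \<in> Ip p" using i I_eq by blast
    moreover from this have "V i m k \<in> Cf (max m k) p" unfolding Cf_def by fastforce
    ultimately show ?thesis unfolding \<alpha>_def by blast
  qed
  have \<alpha>_E: "\<exists>i m k. i \<in> I \<and> W = V i m k" if "W \<in> \<alpha>" for W
    using that unfolding \<alpha>_def Cf_def I_eq by blast
  have "P_property P r (point_finite X) \<alpha>"
    unfolding \<alpha>_def
  proof (rule P_property_of_double_index[OF dir ncd])
    show "Cf m p \<subseteq> Cf n q" if "m \<le> n" "p \<in> P" "q \<in> P" "(p, q) \<in> r" for m n p q
      using Ip_mono[OF that(2-4)] that(1) unfolding Cf_def by fastforce
    show "point_finite X (Cf n p)" if p: "p \<in> P" for n p
      unfolding point_finite_def
    proof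
      fix x assume x: "x \<in> topspace X"
      have "{W \<in> Cf n p. x \<in> W} \<subseteq> (\<Union>m\<le>n. \<Union>k\<le>n. (\<lambda>i. V i m k) ` {i \<in> Ip p. t m k < g i x})"
        unfolding Cf_def V_def by blast
      moreover have "finite \<dots>"
        using fin[OF p x] by (intro finite_UN_I finite_imageI) (auto simp: t_def)
      ultimately show "finite {W \<in> Cf n p. x \<in> W}" by (rule finite_subset)
    qed
  qed
  moreover have "almost_subbase X \<alpha>"
  proof (rule almost_subbase_of_separating_family[OF comp haus])
    show "\<exists>U. U_representation X W U" if "W \<in> \<alpha>" for W
      using \<alpha>_E[OF that] U_representation_superlevel[OF cont] unfolding V_def by blast
    have split: "\<exists>W\<in>\<alpha>. \<exists>W'\<in>\<alpha>. \<exists>C. closedin X C \<and> W' \<subseteq> C \<and> C \<subseteq> W \<and> x \<in> W' \<and> y \<notin> W"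
      if xy: "x \<in> topspace X" "y \<in> topspace X" and i: "i \<in> I" "g i y < g i x" for x y i
    proof -
      obtain m k where mk: "g i y < t m k" "t m k < g i x"
        using rational_between[OF nonneg[OF i(1) xy(2)] i(2)] unfolding t_def by blast
      have "0 \<le> t m k" by (simp add: t_def)
      from rational_between[OF this mk(2)] obtain m' k' where mk': "t m k < t m' k'" "t m' k' < g i x"
        unfolding t_def by blast
      have "V i m' k' \<subseteq> {z \<in> topspace X. t m' k' \<le> g i z}" "{z \<in> topspace X. t m' k' \<le> g i z} \<subseteq> V i m k"
        "x \<in> V i m' k'" "y \<notin> V i m k"
        using xy mk mk' unfolding V_def by auto
      then show ?thesis
        using V_\<alpha>[OF i(1), of m k] V_\<alpha>[OF i(1), of m' k']
          closedin_superlevel[OF cont[OF i(1)], of "t m' k'"] by meson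
    qed
    show "\<exists>W\<in>\<alpha>. \<exists>W'\<in>\<alpha>. \<exists>C. closedin X C \<and> W' \<subseteq> C \<and> C \<subseteq> W \<and> (x \<in> W' \<and> y \<notin> W \<or> y \<in> W' \<and> x \<notin> W)"
      if xy: "x \<in> topspace X" "y \<in> topspace X" "x \<noteq> y" for x y
    proof -
      obtain i where "i \<in> I" "g i x \<noteq> g i y" using sep xy by blast
      then consider "g i y < g i x" | "g i x < g i y" by linarith
      then show ?thesis
      proof cases
        case 1
        from split[OF xy(1,2) \<open>i \<in> I\<close> this] show ?thesis by blast
      next
        case 2
        from split[OF xy(2,1) \<open>i \<in> I\<close> this] show ?thesis by blast
      qed
    qed
  qed
  ultimately show ?thesis by blast
qed

lemma point_network_imp_almost_subbase:
  fixes X :: "'a topology"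
  assumes dir: "directed_set P r" and ncd: "\<not> countably_directed P r"
    and comp: "compact_space X" and haus: "Hausdorff_space X"
    and net: "P_point_network P r additively_Noetherian X N"
  shows "\<exists>\<alpha>. almost_subbase X \<alpha> \<and> P_property P r (point_finite X) \<alpha>"
proof -
  obtain \<alpha> where \<alpha>: "P_property P r (point_finite X) \<alpha>" "\<forall>V\<in>\<alpha>. cozero_set X V"
    "\<forall>x\<in>topspace X. \<forall>y\<in>topspace X. x \<noteq> y \<longrightarrow> (\<exists>V\<in>\<alpha>. x \<in> V \<longleftrightarrow> y \<notin> V)"
    using point_finite_T0_separating_cozero_family[OF assms] by (elim exE conjE) (rule that)
  obtain A where A: "ordered_as P r A \<alpha>" "\<forall>p\<in>P. point_finite X (A p)"
    using \<alpha>(1) unfolding P_property_def by blast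
  have "\<forall>V\<in>\<alpha>. \<exists>f. continuous_map X euclideanreal f \<and>
      (\<forall>x\<in>topspace X. 0 \<le> f x \<and> (x \<in> V \<longleftrightarrow> 0 < f x))"
  proof
    fix V assume "V \<in> \<alpha>"
    then have "cozero_set X V" using \<alpha>(2) by blast
    from cozero_setD[OF this] obtain f where "continuous_map X euclideanreal f"
      "\<forall>x\<in>topspace X. 0 \<le> f x" "V = {x \<in> topspace X. 0 < f x}"
      by blast
    then show "\<exists>f. continuous_map X euclideanreal f \<and>
        (\<forall>x\<in>topspace X. 0 \<le> f x \<and> (x \<in> V \<longleftrightarrow> 0 < f x))"
      by (intro exI[of _ f]) simp
  qed
  from bchoice[OF this] obtain g where g: "\<forall>V\<in>\<alpha>. continuous_map X euclideanreal (g V) \<and>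
      (\<forall>x\<in>topspace X. 0 \<le> g V x \<and> (x \<in> V \<longleftrightarrow> 0 < g V x))"
    by (rule exE)
  show ?thesis
  proof (rule almost_subbase_of_functions[OF dir ncd comp haus A(1), of g])
    show "continuous_map X euclideanreal (g V)" if "V \<in> \<alpha>" for V
      using bspec[OF g that] by blast
    show "0 \<le> g V x" if "V \<in> \<alpha>" "x \<in> topspace X" for V x
      using bspec[OF g that(1)] that(2) by blast
    show "finite {V \<in> A p. e < g V x}" if p: "p \<in> P" and x: "x \<in> topspace X" and e: "0 < e" for p x e
    proof (rule finite_subset)
      show "finite {V \<in> A p. x \<in> V}" using A(2) p x unfolding point_finite_def by blast
      show "{V \<in> A p. e < g V x} \<subseteq> {V \<in> A p. x \<in> V}"
      proof safe
        fix V assume V: "V \<in> A p" "e < g V x"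
        then have "V \<in> \<alpha>" using A(1) p unfolding ordered_as_def by blast
        moreover have "0 < g V x" using V(2) e by simp
        ultimately show "x \<in> V" using bspec[OF g] x by blast
      qed
    qed
    show "\<exists>V\<in>\<alpha>. g V x \<noteq> g V y" if xy: "x \<in> topspace X" "y \<in> topspace X" "x \<noteq> y" for x y
    proof -
      obtain V where V: "V \<in> \<alpha>" "x \<in> V \<longleftrightarrow> y \<notin> V" using \<alpha>(3) xy by meson
      then have "0 < g V x \<longleftrightarrow> \<not> 0 < g V y" using bspec[OF g V(1)] xy(1,2) by blast
      then show ?thesis using V(1) by force
    qed
  qed
qed

section \<open>Function spaces of filter spaces\<close>

text \<open>The points at which \<open>f\<close> is close to \<open>f None\<close> form a neighbourhood of the only nonisolated point, so a
compact set contains only finitely many others.\<close>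

lemma compact_in_filter_space_c0:
  fixes f :: "'s option \<Rightarrow> real"
  assumes F: "F \<le> principal S" and K: "compactin (filter_space S F) K"
    and f: "continuous_map (filter_space S F) euclideanreal f" and e: "0 < e"
  shows "finite {z \<in> K. e \<le> \<bar>f z - f None\<bar>}"
proof -
  let ?Z = "filter_space S F"
  have top: "topspace ?Z = insert None (Some ` S)" using F by (rule topspace_filter_space)
  define G where "G = {z \<in> topspace ?Z. - e < - \<bar>f z - f None\<bar>}"
  have "openin ?Z G"
    unfolding G_def using f by (intro openin_superlevel continuous_intros) simp_all
  moreover have "openin ?Z {Some s}" if "s \<in> S" for s
    unfolding openin_filter_space using that by blast
  ultimately have "\<forall>U\<in>insert G ((\<lambda>s. {Some s}) ` S). openin ?Z U" by blast
  moreover have "K \<subseteq> \<Union>(insert G ((\<lambda>s. {Some s}) ` S))"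
  proof
    fix z assume "z \<in> K"
    then have "z \<in> insert None (Some ` S)" using K top compactin_subset_topspace by blast
    moreover have "None \<in> G" unfolding G_def top using e by simp
    ultimately show "z \<in> \<Union>(insert G ((\<lambda>s. {Some s}) ` S))" by blast
  qed
  ultimately obtain \<F> where \<F>: "finite \<F>" "\<F> \<subseteq> insert G ((\<lambda>s. {Some s}) ` S)" "K \<subseteq> \<Union>\<F>"
    using K unfolding compactin_def by meson
  have "{z \<in> K. e \<le> \<bar>f z - f None\<bar>} \<subseteq> \<Union>(\<F> - {G})"
    using \<F>(3) unfolding G_def by fastforce
  moreover have "finite (\<Union>(\<F> - {G}))"
    using \<F>(1,2) by (intro finite_Union) auto
  ultimately show ?thesis by (rule finite_subset)
qed

text \<open>The coordinates of \<open>C\<^sub>p(S(F))\<close> are normalized by subtracting the value at \<open>*\<close>, after which they vanish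
along each compact set of the cover; the value at \<open>*\<close> itself is kept as one further coordinate. The
boolean component of an index selects the positive or the negative part.\<close>

lemma embeds_in_Cp_imp_almost_subbase:
  fixes X :: "'a topology"
  assumes dir: "directed_set P r" and ncd: "\<not> countably_directed P r"
    and comp: "compact_space X" and haus: "Hausdorff_space X"
    and emb: "embeds_in_Cp_of_filter_space TYPE('s) P r X"
  shows "\<exists>\<alpha>. almost_subbase X \<alpha> \<and> P_property P r (point_finite X) \<alpha>"
proof -
  obtain S :: "'s set" and F where S: "free_filter_on S F"
    "has_ordered_compact_cover P r (filter_space S F)"
    "embeds_in X (Cp_space (filter_space S F))"
    using emb unfolding embeds_in_Cp_of_filter_space_def by blast
  let ?Z = "filter_space S F"
  have F: "F \<le> principal S" using S(1) unfolding free_filter_on_def by blast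
  note top = topspace_filter_space[OF F]
  obtain K where K: "ordered_as P r K (topspace ?Z)" "\<forall>p\<in>P. compactin ?Z (K p)"
    using S(2) unfolding has_ordered_compact_cover_def by blast
  obtain f where f: "embedding_map X (Cp_space ?Z) f"
    using S(3) unfolding embeds_in_def by blast
  have fc: "continuous_map X (Cp_space ?Z) f"
    using f unfolding embedding_map_def
    by (meson continuous_map_in_subtopology homeomorphic_imp_continuous_map)
  have finj: "inj_on f (topspace X)"
    using f unfolding embedding_map_def by (rule homeomorphic_imp_injective_map)
  have fprod: "continuous_map X (product_topology (\<lambda>_. euclideanreal) (topspace ?Z)) f"
    and fcont: "\<And>x. x \<in> topspace X \<Longrightarrow> continuous_map ?Z euclideanreal (f x)"
    using fc unfolding Cp_space_def continuous_map_in_subtopology by auto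
  have coord: "continuous_map X euclideanreal (\<lambda>x. f x z)" if "z \<in> topspace ?Z" for z
    using fprod that unfolding continuous_map_componentwise by blast
  have fext: "f x \<in> extensional (topspace ?Z)" if "x \<in> topspace X" for x
    using fprod that unfolding continuous_map_componentwise by auto
  define v where "v z x = (if z = None then f x None else f x z - f x None)" for z x
  define g :: "'s option \<times> bool \<Rightarrow> 'a \<Rightarrow> real"
    where "g i x = max 0 (if snd i then v (fst i) x else - v (fst i) x)" for i x
  have vc: "continuous_map X euclideanreal (v z)" if "z \<in> topspace ?Z" for z
    using coord[OF that] coord[of None] top unfolding v_def
    by (cases "z = None") (auto intro!: continuous_intros)
  obtain p0 where p0: "p0 \<in> P" using dir unfolding directed_set_def by blast
  define I where "I p = insert None (K p) \<times> (UNIV :: bool set)" for p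
  have ord: "ordered_as P r I (topspace ?Z \<times> UNIV)"
    unfolding ordered_as_def
  proof (intro conjI ballI impI)
    have "topspace ?Z = (\<Union>p\<in>P. insert None (K p))"
      using K(1) top p0 unfolding ordered_as_def by auto
    then show "topspace ?Z \<times> UNIV = (\<Union>p\<in>P. I p)" unfolding I_def by auto
    show "I p \<subseteq> I q" if "p \<in> P" "q \<in> P" "(p, q) \<in> r" for p q
      using K(1) that unfolding ordered_as_def I_def by blast
  qed
  show ?thesis
  proof (rule almost_subbase_of_functions[OF dir ncd comp haus ord, of g])
    show "continuous_map X euclideanreal (g i)" if "i \<in> topspace ?Z \<times> UNIV" for i
    proof -
      have "continuous_map X euclideanreal (v (fst i))" using that by (intro vc) auto
      then show ?thesis unfolding g_def by (cases "snd i") (auto intro!: continuous_intros)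
    qed
    show "0 \<le> g i x" for i x unfolding g_def by simp
    show "finite {i \<in> I p. e < g i x}" if p: "p \<in> P" and x: "x \<in> topspace X" and e: "0 < e" for p x e
    proof (rule finite_subset)
      let ?B = "insert None {z \<in> K p. e \<le> \<bar>f x z - f x None\<bar>} \<times> (UNIV :: bool set)"
      have "finite {z \<in> K p. e \<le> \<bar>f x z - f x None\<bar>}"
        using compact_in_filter_space_c0[OF F _ fcont[OF x] e] K(2) p by blast
      then show "finite ?B" by simp
      show "{i \<in> I p. e < g i x} \<subseteq> ?B"
        unfolding I_def g_def v_def using e by (auto split: if_splits)
    qed
    show "\<exists>i\<in>topspace ?Z \<times> UNIV. g i x \<noteq> g i y"
      if xy: "x \<in> topspace X" "y \<in> topspace X" "x \<noteq> y" for x y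
    proof -
      have "f x \<noteq> f y" using finj xy by (meson inj_on_def)
      then obtain z where z: "z \<in> topspace ?Z" "f x z \<noteq> f y z"
        using extensionalityI[OF fext[OF xy(1)] fext[OF xy(2)]] by blast
      have "\<exists>z\<in>topspace ?Z. v z x \<noteq> v z y"
      proof (cases "f x None = f y None")
        case True
        then have "v z x \<noteq> v z y" using z(2) unfolding v_def by (cases z) auto
        then show ?thesis using z(1) by blast
      next
        case False
        then have "v None x \<noteq> v None y" unfolding v_def by simp
        then show ?thesis using top by blast
      qed
      then obtain w where w: "w \<in> topspace ?Z" "v w x \<noteq> v w y" by blast
      have "g (w, True) x \<noteq> g (w, True) y \<or> g (w, False) x \<noteq> g (w, False) y"
        using w(2) unfolding g_def by (simp add: max_def split: if_splits)
      then show ?thesis using w(1) by blast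
    qed
  qed
qed

text \<open>If \<open>a\<close> and \<open>b\<close> are nonnegative, \<open>V\<close> is the cozero set of \<open>a\<close> and \<open>Z\<close> the zero set of \<open>b\<close>, the
function is \<open>a / (a + b)\<close>.\<close>

lemma ratio_function:
  assumes "zero_set X Z" "cozero_set X V" "Z \<subseteq> V"
  shows "\<exists>f. continuous_map X euclideanreal f \<and> (\<forall>x\<in>topspace X. f x \<noteq> 0 \<longleftrightarrow> x \<in> V) \<and>
    (\<forall>x\<in>topspace X. f x = 1 \<longleftrightarrow> x \<in> Z)"
proof -
  obtain a where a: "continuous_map X euclideanreal a" "\<forall>x\<in>topspace X. 0 \<le> a x"
    "V = {x \<in> topspace X. 0 < a x}"
    using cozero_setD[OF assms(2)] by blast
  obtain b where b: "continuous_map X euclideanreal b" "\<forall>x\<in>topspace X. 0 \<le> b x"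
    "Z = {x \<in> topspace X. b x = 0}"
    using zero_setD[OF assms(1)] by blast
  have pos: "0 < a x + b x" if "x \<in> topspace X" for x
  proof (cases "b x = 0")
    case True
    then have "x \<in> V" using b(3) that assms(3) by blast
    then show ?thesis using True a(3) by simp
  next
    case False
    then show ?thesis using that a(2) b(2) by (metis add_nonneg_pos order_le_less)
  qed
  have "continuous_map X euclideanreal (\<lambda>x. a x / (a x + b x))"
    using a(1) b(1) pos by (intro continuous_intros) (auto simp: less_imp_neq[symmetric])
  moreover have "a x / (a x + b x) \<noteq> 0 \<longleftrightarrow> x \<in> V" "a x / (a x + b x) = 1 \<longleftrightarrow> x \<in> Z"
    if "x \<in> topspace X" for x
    using pos[OF that] that a(2,3) b(2,3) by (auto simp: field_simps less_le)
  ultimately show ?thesis by blast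
qed

text \<open>The finest neighbourhood filter of the point \<open>*\<close> for which every \<open>J \<union> {*}\<close> with \<open>J \<in> \<J>\<close> is compact.\<close>

definition cofinite_on_each :: "'s set set \<Rightarrow> 's filter" where
  "cofinite_on_each \<J> = Abs_filter (\<lambda>Q. \<forall>J\<in>\<J>. finite {s \<in> J. \<not> Q s})"

lemma eventually_cofinite_on_each:
  "eventually Q (cofinite_on_each \<J>) \<longleftrightarrow> (\<forall>J\<in>\<J>. finite {s \<in> J. \<not> Q s})"
proof -
  have "is_filter (\<lambda>Q. \<forall>J\<in>\<J>. finite {s \<in> J. \<not> Q s})"
  proof
    fix Q R assume "\<forall>J\<in>\<J>. finite {s \<in> J. \<not> Q s}" "\<forall>J\<in>\<J>. finite {s \<in> J. \<not> R s}"
    moreover have "{s \<in> J. \<not> (Q s \<and> R s)} = {s \<in> J. \<not> Q s} \<union> {s \<in> J. \<not> R s}" for J by blast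
    ultimately show "\<forall>J\<in>\<J>. finite {s \<in> J. \<not> (Q s \<and> R s)}" by simp
  next
    fix Q R assume *: "\<forall>s. Q s \<longrightarrow> R s" "\<forall>J\<in>\<J>. finite {s \<in> J. \<not> Q s}"
    have "{s \<in> J. \<not> R s} \<subseteq> {s \<in> J. \<not> Q s}" for J using *(1) by blast
    then show "\<forall>J\<in>\<J>. finite {s \<in> J. \<not> R s}" using *(2) by (meson finite_subset)
  qed simp
  then show ?thesis unfolding cofinite_on_each_def by (simp add: eventually_Abs_filter)
qed

text \<open>The function \<open>s \<mapsto> g s x\<close>, extended by \<open>0\<close> at \<open>*\<close>, is continuous on \<open>S(F)\<close> because it vanishes along
each \<open>Ip p\<close>; an injective continuous map from a compact space to a Hausdorff space is an embedding.\<close>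

lemma embeds_in_Cp_of_functions:
  fixes X :: "'a topology" and g :: "'s \<Rightarrow> 'a \<Rightarrow> real"
  assumes dir: "directed_set P r" and comp: "compact_space X"
    and S: "infinite S" and ord: "ordered_as P r Ip S"
    and cont: "\<And>s. s \<in> S \<Longrightarrow> continuous_map X euclideanreal (g s)"
    and fin: "\<And>p x e. p \<in> P \<Longrightarrow> x \<in> topspace X \<Longrightarrow> 0 < e \<Longrightarrow> finite {s \<in> Ip p. e \<le> \<bar>g s x\<bar>}"
    and sep: "\<And>x y. x \<in> topspace X \<Longrightarrow> y \<in> topspace X \<Longrightarrow> x \<noteq> y \<Longrightarrow> \<exists>s\<in>S. g s x \<noteq> g s y"
  shows "embeds_in_Cp_of_filter_space TYPE('s) P r X"
proof -
  define F where "F = cofinite_on_each (Ip ` P)"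
  have S_eq: "S = (\<Union>p\<in>P. Ip p)" using ord unfolding ordered_as_def by blast
  have ev: "eventually Q F \<longleftrightarrow> (\<forall>p\<in>P. finite {s \<in> Ip p. \<not> Q s})" for Q
    unfolding F_def eventually_cofinite_on_each by simp
  have sub_finite: "finite {s \<in> Ip p. s \<notin> U}" if "finite (S - U)" "p \<in> P" for p U
    using that S_eq by (intro finite_subset[OF _ that(1)]) auto
  have F_le: "F \<le> principal S"
    unfolding le_principal ev using sub_finite[of S] by simp
  let ?Z = "filter_space S F"
  note top = topspace_filter_space[OF F_le]
  have free: "free_filter_on S F"
    unfolding free_filter_on_def
  proof (intro conjI F_le)
    show "\<Inter>{U. U \<subseteq> S \<and> eventually (\<lambda>s. s \<in> U) F} = {}"
    proof (rule ccontr)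
      assume "\<Inter>{U. U \<subseteq> S \<and> eventually (\<lambda>s. s \<in> U) F} \<noteq> {}"
      then obtain t where t: "\<And>U. U \<subseteq> S \<Longrightarrow> eventually (\<lambda>s. s \<in> U) F \<Longrightarrow> t \<in> U" by blast
      have "finite (S - (S - {t}))" by (rule finite_subset[of _ "{t}"]) auto
      then have "eventually (\<lambda>s. s \<in> S - {t}) F" unfolding ev using sub_finite by blast
      then have "t \<in> S - {t}" using t[of "S - {t}"] by blast
      then show False by blast
    qed
  qed
  have cover: "has_ordered_compact_cover P r ?Z"
    unfolding has_ordered_compact_cover_def
  proof (intro exI[of _ "\<lambda>p. insert None (Some ` Ip p)"] conjI ballI)
    show "ordered_as P r (\<lambda>p. insert None (Some ` Ip p)) (topspace ?Z)"
      unfolding ordered_as_def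
    proof (intro conjI ballI impI)
      obtain p where "p \<in> P" using dir unfolding directed_set_def by blast
      moreover have "Some ` S = (\<Union>p\<in>P. Some ` Ip p)" unfolding S_eq by (rule image_UN)
      ultimately show "topspace ?Z = (\<Union>p\<in>P. insert None (Some ` Ip p))" unfolding top by blast
      show "insert None (Some ` Ip p) \<subseteq> insert None (Some ` Ip q)"
        if "p \<in> P" "q \<in> P" "(p, q) \<in> r" for p q
      proof -
        have "Ip p \<subseteq> Ip q" using ord that unfolding ordered_as_def by meson
        then show ?thesis by (intro insert_mono image_mono)
      qed
    qed
    fix p assume p: "p \<in> P"
    show "compactin ?Z (insert None (Some ` Ip p))"
      unfolding compactin_def
    proof (intro conjI allI impI)
      show "insert None (Some ` Ip p) \<subseteq> topspace ?Z" 
        unfolding top using S_eq p by blast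
      fix \<U> assume U: "(\<forall>U\<in>\<U>. openin ?Z U) \<and> insert None (Some ` Ip p) \<subseteq> \<Union>\<U>"
      then obtain G where G: "G \<in> \<U>" "None \<in> G" by blast
      then have "eventually (\<lambda>s. Some s \<in> G) F" using U openin_filter_space by blast
      then have fin_rest: "finite {s \<in> Ip p. Some s \<notin> G}" unfolding ev using p by blast
      have "\<forall>s\<in>Ip p. \<exists>U. U \<in> \<U> \<and> Some s \<in> U" using U by blast
      from bchoice[OF this] obtain u where u: "\<forall>s\<in>Ip p. u s \<in> \<U> \<and> Some s \<in> u s" by (rule exE)
      show "\<exists>\<F>. finite \<F> \<and> \<F> \<subseteq> \<U> \<and> insert None (Some ` Ip p) \<subseteq> \<Union>\<F>"
      proof (intro exI[of _ "insert G (u ` {s \<in> Ip p. Some s \<notin> G})"] conjI)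
        show "finite (insert G (u ` {s \<in> Ip p. Some s \<notin> G}))" using fin_rest by simp
        show "insert G (u ` {s \<in> Ip p. Some s \<notin> G}) \<subseteq> \<U>" using G(1) u by blast
        show "insert None (Some ` Ip p) \<subseteq> \<Union>(insert G (u ` {s \<in> Ip p. Some s \<notin> G}))"
          using G(2) u by blast
      qed
    qed
  qed
  define e where "e x = (\<lambda>z\<in>topspace ?Z. case z of None \<Rightarrow> 0 | Some s \<Rightarrow> g s x)" for x
  have e_None: "e x None = 0" for x unfolding e_def top by simp
  have e_Some: "e x (Some s) = g s x" if "s \<in> S" for x s unfolding e_def top using that by simp
  have e_cont: "continuous_map ?Z euclideanreal (e x)" if x: "x \<in> topspace X" for x
    unfolding continuous_map_def
  proof (intro conjI allI impI)
    fix U :: "real set" assume U: "openin euclideanreal U"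
    show "openin ?Z {z \<in> topspace ?Z. e x z \<in> U}"
      unfolding openin_filter_space
    proof (intro conjI impI)
      show "{z \<in> topspace ?Z. e x z \<in> U} \<subseteq> insert None (Some ` S)" using top by blast
      assume "None \<in> {z \<in> topspace ?Z. e x z \<in> U}"
      then have "0 \<in> U" using e_None by simp
      then obtain d where d: "0 < d" "ball 0 d \<subseteq> U"
        using U openE by (metis open_openin)
      show "eventually (\<lambda>s. Some s \<in> {z \<in> topspace ?Z. e x z \<in> U}) F"
        unfolding ev
      proof
        fix p assume p: "p \<in> P"
        show "finite {s \<in> Ip p. Some s \<notin> {z \<in> topspace ?Z. e x z \<in> U}}"
        proof (rule finite_subset[OF _ fin[OF p x d(1)]], rule subsetI)
          fix s assume "s \<in> {s \<in> Ip p. Some s \<notin> {z \<in> topspace ?Z. e x z \<in> U}}"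
          then have s: "s \<in> Ip p" "Some s \<notin> {z \<in> topspace ?Z. e x z \<in> U}" by blast+
          then have "s \<in> S" using S_eq p by blast
          then have "g s x \<notin> U" using s(2) e_Some top by auto
          then have "g s x \<notin> ball 0 d" using d(2) by blast
          then show "s \<in> {s \<in> Ip p. d \<le> \<bar>g s x\<bar>}" using s(1) by simp
        qed
      qed
    qed
  qed simp
  have "continuous_map X (product_topology (\<lambda>_. euclideanreal) (topspace ?Z)) e"
    unfolding continuous_map_componentwise
  proof (intro conjI ballI)
    show "e ` topspace X \<subseteq> extensional (topspace ?Z)" unfolding e_def by auto
    fix z assume z: "z \<in> topspace ?Z"
    show "continuous_map X euclideanreal (\<lambda>x. e x z)"
    proof (cases z)
      case None
      then show ?thesis by (simp add: e_None)
    next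
      case (Some s)
      then have "s \<in> S" using z top by blast
      then show ?thesis using cont Some by (simp add: e_Some)
    qed
  qed
  then have "continuous_map X (Cp_space ?Z) e"
    unfolding Cp_space_def using e_cont by (simp add: continuous_map_in_subtopology image_subset_iff)
  moreover have "Hausdorff_space (Cp_space ?Z)"
    unfolding Cp_space_def
    by (intro Hausdorff_space_subtopology) (simp add: Hausdorff_space_product_topology)
  moreover have "inj_on e (topspace X)"
  proof (rule inj_onI, rule ccontr)
    fix x y assume xy: "x \<in> topspace X" "y \<in> topspace X" "e x = e y" "x \<noteq> y"
    then obtain s where s: "s \<in> S" "g s x \<noteq> g s y" using sep by blast
    then show False using e_Some[OF s(1)] xy(3) by metis
  qed
  ultimately have "embedding_map X (Cp_space ?Z) e"
    using comp by (intro continuous_imp_embedding_map)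
  then show ?thesis
    unfolding embeds_in_Cp_of_filter_space_def embeds_in_def
    using S free cover by blast
qed

lemma subbase_of_neighbourhood:
  assumes "subbase_of X \<S>" "openin X G" "x \<in> G"
  obtains \<T> where "finite \<T>" "\<T> \<subseteq> \<S>" "x \<in> topspace X \<inter> \<Inter>\<T>" "topspace X \<inter> \<Inter>\<T> \<subseteq> G"
proof -
  have "(arbitrary union_of (finite intersection_of (\<lambda>A. A \<in> \<S>) relative_to topspace X)) G"
    using assms(1,2) unfolding subbase_of_def by metis
  then obtain \<U> where \<U>: "\<U> \<subseteq> Collect (finite intersection_of (\<lambda>A. A \<in> \<S>) relative_to topspace X)"
    "\<Union>\<U> = G"
    unfolding union_of_def by blast
  then obtain B where B: "B \<in> \<U>" "x \<in> B" using assms(3) by blast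
  then have "(finite intersection_of (\<lambda>A. A \<in> \<S>) relative_to topspace X) B" using \<U>(1) by blast
  then obtain C where C: "(finite intersection_of (\<lambda>A. A \<in> \<S>)) C" "topspace X \<inter> C = B"
    unfolding relative_to_def by blast
  then obtain \<T> where T: "finite \<T>" "\<T> \<subseteq> Collect (\<lambda>A. A \<in> \<S>)" "\<Inter>\<T> = C"
    unfolding intersection_of_def by blast
  have "B \<subseteq> G" using B(1) \<U>(2) by blast
  with T C(2) B(2) show ?thesis by (intro that[of \<T>]) auto
qed

lemma subbase_of_separates:
  assumes "subbase_of X \<S>" "Hausdorff_space X" "x \<in> topspace X" "y \<in> topspace X" "x \<noteq> y"
  shows "\<exists>S\<in>\<S>. x \<in> S \<and> y \<notin> S"
proof (rule ccontr)
  assume *: "\<not> ?thesis"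
  obtain G where G: "openin X G" "x \<in> G" "y \<notin> G"
    using assms(2-5) unfolding Hausdorff_space_def disjnt_iff by metis
  obtain \<T> where "\<T> \<subseteq> \<S>" "x \<in> topspace X \<inter> \<Inter>\<T>" "topspace X \<inter> \<Inter>\<T> \<subseteq> G"
    using subbase_of_neighbourhood[OF assms(1) G(1,2)] by metis
  then show False using * G(3) assms(4) by blast
qed

text \<open>For \<open>V \<in> \<alpha>\<close> and \<open>n \<ge> 1\<close> the coordinate is a function that is \<open>1\<close> exactly on \<open>U\<^bsub>2n-1\<^esub>(V)\<close> and \<open>0\<close>
exactly off \<open>U\<^bsub>2n\<^esub>(V)\<close>. It is supported in \<open>V\<close>, so point finiteness is inherited, and it separates
two points whenever \<open>V\<close> or the complement of \<open>U\<^bsub>2n-1\<^esub>(V)\<close> does.\<close>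

lemma almost_subbase_imp_embeds_in_Cp:
  fixes X :: "'a topology"
  assumes dir: "directed_set P r" and ncd: "\<not> countably_directed P r"
    and comp: "compact_space X" and haus: "Hausdorff_space X"
    and \<alpha>: "almost_subbase X \<alpha>" "P_property P r (point_finite X) \<alpha>"
  shows "embeds_in_Cp_of_filter_space TYPE('a set \<times> nat) P r X"
proof -
  obtain U where U: "\<forall>V\<in>\<alpha>. U_representation X V (U V)"
    and sub: "subbase_of X (\<alpha> \<union> {topspace X - U V (2 * n - 1) | V n. V \<in> \<alpha> \<and> n \<ge> 1})"
    using \<alpha>(1)[unfolded almost_subbase_def] by (elim exE conjE) (rule that)
  obtain A where A: "ordered_as P r A \<alpha>" "\<forall>p\<in>P. point_finite X (A p)"
    using \<alpha>(2) unfolding P_property_def by blast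
  have UV: "U V n \<subseteq> V" if "V \<in> \<alpha>" "n \<ge> 1" for V n
    by (rule U_representation_subset[OF bspec[OF U that(1)] that(2)])
  define good where "good V n f \<longleftrightarrow> continuous_map X euclideanreal f \<and>
      (\<forall>x\<in>topspace X. f x \<noteq> 0 \<longleftrightarrow> x \<in> U V (2 * n)) \<and>
      (\<forall>x\<in>topspace X. f x = 1 \<longleftrightarrow> x \<in> U V (2 * n - 1))" for V n and f :: "'a \<Rightarrow> real"
  have "\<exists>f. good V n f" if V: "V \<in> \<alpha>" "n \<ge> 1" for V n
  proof -
    have rep: "U_representation X V (U V)" using U V(1) by blast
    then have "zero_set X (U V (2 * n - 1))" "cozero_set X (U V (2 * n))"
      using V(2) unfolding U_representation_def by auto
    moreover have "U V (2 * n - 1) \<subseteq> U V (2 * n)"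
      using V(2) by (intro U_representation_mono[OF rep]) auto
    ultimately show ?thesis unfolding good_def by (rule ratio_function)
  qed
  then obtain f where f: "\<And>V n. V \<in> \<alpha> \<Longrightarrow> n \<ge> 1 \<Longrightarrow> good V n (f V n)" by metis
  define g :: "'a set \<times> nat \<Rightarrow> 'a \<Rightarrow> real"
    where "g s x = (if fst s \<in> \<alpha> \<and> snd s \<ge> 1 then f (fst s) (snd s) x else 0)" for s x
  have g_supp: "x \<in> fst s" if "g s x \<noteq> 0" "x \<in> topspace X" for s x
  proof -
    have s: "fst s \<in> \<alpha>" "snd s \<ge> 1" "f (fst s) (snd s) x \<noteq> 0"
      using that(1) unfolding g_def by (auto split: if_splits)
    then have "x \<in> U (fst s) (2 * snd s)" using f[OF s(1,2)] that(2) unfolding good_def by blast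
    then show ?thesis using UV[of "fst s" "2 * snd s"] s(1,2) by auto
  qed
  \<comment> \<open>The empty set is added, with the zero function, to make the index set infinite if \<open>\<alpha>\<close> is empty.\<close>
  define Cf where "Cf n p = insert {} (A p) \<times> {..n}" for n :: nat and p
  have Cf_mono: "Cf m p \<subseteq> Cf n q" if "m \<le> n" "p \<in> P" "q \<in> P" "(p, q) \<in> r" for m n p q
    using A(1) that unfolding ordered_as_def Cf_def by fastforce
  let ?Q = "\<lambda>J. \<forall>x\<in>topspace X. \<forall>e>0. finite {s \<in> J. e \<le> \<bar>g s x\<bar>}"
  have "P_property P r ?Q (\<Union>n. \<Union>p\<in>P. Cf n p)"
  proof (rule P_property_of_double_index[OF dir ncd Cf_mono])
    show "?Q (Cf n p)" if p: "p \<in> P" for n p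
    proof (intro ballI allI impI)
      fix x and e :: real assume x: "x \<in> topspace X" and e: "0 < e"
      have "{s \<in> Cf n p. e \<le> \<bar>g s x\<bar>} \<subseteq> {V \<in> A p. x \<in> V} \<times> {..n}"
      proof
        fix s assume s: "s \<in> {s \<in> Cf n p. e \<le> \<bar>g s x\<bar>}"
        then have "x \<in> fst s" using g_supp[of s x] x e by force
        then show "s \<in> {V \<in> A p. x \<in> V} \<times> {..n}" using s unfolding Cf_def by auto
      qed
      moreover have "finite ({V \<in> A p. x \<in> V} \<times> {..n})"
        using A(2) p x unfolding point_finite_def by blast
      ultimately show "finite {s \<in> Cf n p. e \<le> \<bar>g s x\<bar>}" by (rule finite_subset)
    qed
  qed
  then obtain Ip where Ip: "ordered_as P r Ip (\<Union>n. \<Union>p\<in>P. Cf n p)" "\<forall>p\<in>P. ?Q (Ip p)"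
    unfolding P_property_def by blast
  have index: "(\<Union>n. \<Union>p\<in>P. Cf n p) = insert {} \<alpha> \<times> UNIV"
    using A(1) dir unfolding Cf_def ordered_as_def directed_set_def by fastforce
  show ?thesis
  proof (rule embeds_in_Cp_of_functions[OF dir comp _ Ip(1)[unfolded index], of g])
    show "infinite (insert {} \<alpha> \<times> (UNIV :: nat set))" by (simp add: finite_cartesian_product_iff)
    show "continuous_map X euclideanreal (g s)" if "s \<in> insert {} \<alpha> \<times> UNIV" for s
      using f[of "fst s" "snd s"] unfolding g_def good_def
      by (cases "fst s \<in> \<alpha> \<and> snd s \<ge> 1") auto
    show "finite {s \<in> Ip p. e \<le> \<bar>g s x\<bar>}" if "p \<in> P" "x \<in> topspace X" "0 < e" for p x e
      using Ip(2) that by blast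
    show "\<exists>s\<in>insert {} \<alpha> \<times> UNIV. g s x \<noteq> g s y"
      if xy: "x \<in> topspace X" "y \<in> topspace X" "x \<noteq> y" for x y
    proof -
      have split: "g (V, n) x \<noteq> g (V, n) y"
        if V: "V \<in> \<alpha>" "n \<ge> 1" and "(x \<in> U V (2 * n)) \<noteq> (y \<in> U V (2 * n)) \<or>
          (x \<in> U V (2 * n - 1)) \<noteq> (y \<in> U V (2 * n - 1))" for V n
      proof
        assume "g (V, n) x = g (V, n) y"
        then have "f V n x = f V n y" using V unfolding g_def by simp
        moreover have "f V n z \<noteq> 0 \<longleftrightarrow> z \<in> U V (2 * n)" "f V n z = 1 \<longleftrightarrow> z \<in> U V (2 * n - 1)"
          if "z \<in> topspace X" for z
          using f[OF V] that unfolding good_def by blast+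
        ultimately show False using that xy(1,2) by metis
      qed
      obtain S where S: "S \<in> \<alpha> \<union> {topspace X - U V (2 * n - 1) | V n. V \<in> \<alpha> \<and> n \<ge> 1}" "x \<in> S" "y \<notin> S"
        using subbase_of_separates[OF sub haus xy] by blast
      have "\<exists>V\<in>\<alpha>. \<exists>n. g (V, n) x \<noteq> g (V, n) y"
      proof (cases "S \<in> \<alpha>")
        case True
        have rep: "U_representation X S (U S)" using U True by blast
        then obtain n where n: "1 \<le> n" "x \<in> U S (2 * n)"
          using S(2) by (rule U_representation_mem_even)
        have "y \<notin> U S (2 * n)" using UV[OF True, of "2 * n"] n(1) S(3) by auto
        then show ?thesis using split[OF True n(1)] True n(2) by blast
      next
        case False
        then obtain V n where V: "V \<in> \<alpha>" "n \<ge> 1" "S = topspace X - U V (2 * n - 1)" using S(1) by blast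
        then show ?thesis using split[OF V(1,2)] S(2,3) xy(2) by blast
      qed
      then show ?thesis by blast
    qed
  qed
qed


section \<open>From almost subbases to point networks\<close>

text \<open>For a sequence \<open>V\<^sub>i\<close> with always new points \<open>x\<^sub>i\<close>, the sets \<open>Z(V\<^sub>j)\<close> have the finite intersection
property, as \<open>x\<^sub>i\<close> lies in all earlier ones. A common point would belong to infinitely many members
of \<open>\<A>\<close>.\<close>

lemma additively_Noetherian_complements_of_zero_sets:
  assumes comp: "compact_space X" and pf: "point_finite X \<A>"
    and closed: "\<And>V. V \<in> \<A> \<Longrightarrow> closedin X (Z V)" and sub: "\<And>V. V \<in> \<A> \<Longrightarrow> Z V \<subseteq> V"
  shows "additively_Noetherian ((\<lambda>V. topspace X - Z V) ` \<A>)"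
  unfolding additively_Noetherian_iff
proof (intro allI impI, rule ccontr)
  fix B :: "nat \<Rightarrow> 'a set" and x
  assume B: "\<forall>i. B i \<in> (\<lambda>V. topspace X - Z V) ` \<A> \<and> x i \<in> B i"
    and bad: "\<nexists>i j. j < i \<and> x i \<in> B j"
  then have "\<forall>i. \<exists>V. V \<in> \<A> \<and> B i = topspace X - Z V" by blast
  then obtain V where V: "\<And>i. V i \<in> \<A>" "\<And>i. B i = topspace X - Z (V i)" by metis
  have x_Z: "x i \<in> Z (V j)" if "j < i" for i j
    using bad B V(2) that by blast
  have "inj V"
  proof (rule linorder_injI)
    fix j i :: nat assume "j < i"
    then show "V j \<noteq> V i" using x_Z B V(2) by force
  qed
  have "(\<Inter>n. \<Inter>j\<le>n. Z (V j)) \<noteq> {}"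
  proof (rule compact_space_imp_nest[OF comp])
    show "closedin X (\<Inter>j\<le>n. Z (V j))" for n using closed V(1) by (intro closedin_INT) auto
    have "x (Suc n) \<in> (\<Inter>j\<le>n. Z (V j))" for n using x_Z by (simp add: less_Suc_eq_le)
    then show "(\<Inter>j\<le>n. Z (V j)) \<noteq> {}" for n by blast
    show "decseq (\<lambda>n. \<Inter>j\<le>n. Z (V j))"
      unfolding decseq_def by (intro allI impI INF_superset_mono) auto
  qed
  then obtain y where "\<forall>n. y \<in> (\<Inter>j\<le>n. Z (V j))" by blast
  then have y: "y \<in> Z (V j)" for j by blast
  have "range V \<subseteq> {C \<in> \<A>. y \<in> C}" using V(1) sub y by blast
  moreover have "y \<in> topspace X" using y closed V(1) closedin_subset by blast
  ultimately have "finite (range V)"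
    using pf finite_subset unfolding point_finite_def by blast
  then show False using \<open>inj V\<close> finite_imageD infinite_UNIV_nat by blast
qed

text \<open>The number of factors is bounded so that the Noetherian property is preserved; the bound becomes the
second index that \<open>P_property_of_double_index\<close> absorbs.\<close>

primrec bounded_meets :: "'a topology \<Rightarrow> 'a set set \<Rightarrow> nat \<Rightarrow> 'a set set" where
  "bounded_meets X \<S> 0 = {topspace X}"
| "bounded_meets X \<S> (Suc n) = bounded_meets X \<S> n \<union> {S \<inter> G | S G. S \<in> \<S> \<and> G \<in> bounded_meets X \<S> n}"

lemma bounded_meets_mono:
  assumes "\<S> \<subseteq> \<T>" "m \<le> n"
  shows "bounded_meets X \<S> m \<subseteq> bounded_meets X \<T> n"
proof -
  have "bounded_meets X \<S> m \<subseteq> bounded_meets X \<T> m"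
  proof (induction m)
    case (Suc m)
    have "{S \<inter> G | S G. S \<in> \<S> \<and> G \<in> bounded_meets X \<S> m} \<subseteq>
        {S \<inter> G | S G. S \<in> \<T> \<and> G \<in> bounded_meets X \<T> m}"
      using Suc.IH assms(1) by blast
    with Suc.IH show ?case unfolding bounded_meets.simps by (rule Un_mono)
  qed simp
  also have "\<dots> \<subseteq> bounded_meets X \<T> n"
    using assms(2) by (induction n) (auto simp: le_Suc_eq)
  finally show ?thesis .
qed

lemma bounded_meets_Inter:
  assumes "finite \<T>" "\<T> \<subseteq> \<S>"
  shows "topspace X \<inter> \<Inter>\<T> \<in> bounded_meets X \<S> (card \<T>)"
  using assms
proof (induction \<T> rule: finite_induct)
  case (insert T \<T>)
  then have "topspace X \<inter> \<Inter>\<T> \<in> bounded_meets X \<S> (card \<T>)" "T \<in> \<S>" by auto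
  moreover have "topspace X \<inter> \<Inter>(insert T \<T>) = T \<inter> (topspace X \<inter> \<Inter>\<T>)" by blast
  ultimately show ?case using insert.hyps by auto
qed simp

lemma bounded_meets_openin:
  assumes "\<And>S. S \<in> \<S> \<Longrightarrow> openin X S"
  shows "G \<in> bounded_meets X \<S> n \<Longrightarrow> openin X G"
  using assms by (induction n arbitrary: G) auto

lemma bounded_meets_point_additively_Noetherian:
  assumes "point_additively_Noetherian X \<S>"
  shows "point_additively_Noetherian X (bounded_meets X \<S> n)"
proof (induction n)
  case 0
  show ?case
    unfolding point_additively_Noetherian_def by (auto intro: finite_imp_additively_Noetherian)
next
  case (Suc n)
  show ?case
    unfolding point_additively_Noetherian_def
  proof
    fix x assume x: "x \<in> topspace X"
    let ?A = "{G \<in> bounded_meets X \<S> n. x \<in> G}" and ?B = "{S \<in> \<S>. x \<in> S}"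
    have A: "additively_Noetherian ?A" and B: "additively_Noetherian ?B"
      using Suc assms x unfolding point_additively_Noetherian_def by blast+
    have "{G \<in> bounded_meets X \<S> (Suc n). x \<in> G} \<subseteq> ?A \<union> {S \<inter> G | S G. S \<in> ?B \<and> G \<in> ?A}"
      by auto
    then show "additively_Noetherian {G \<in> bounded_meets X \<S> (Suc n). x \<in> G}"
      using additively_Noetherian_Un[OF A additively_Noetherian_Int[OF B A]]
        additively_Noetherian_subset by blast
  qed
qed

text \<open>At each point the sets of \<open>\<alpha>\<close> with a given label form a finite family, and for each fixed \<open>n\<close> the
complements of the zero sets \<open>U\<^bsub>2n-1\<^esub>(V)\<close> form an additively Noetherian one. The index \<open>n\<close> of \<open>B\<close> bounds
both the number of factors and the zero sets in use.\<close>

lemma almost_subbase_imp_base: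
  fixes X :: "'a topology"
  assumes dir: "directed_set P r" and ncd: "\<not> countably_directed P r"
    and comp: "compact_space X"
    and \<alpha>: "almost_subbase X \<alpha>" "P_property P r (point_finite X) \<alpha>"
  shows "\<exists>\<B>. base_of X \<B> \<and> P_property P r (point_additively_Noetherian X) \<B>"
proof -
  obtain U where U: "\<forall>V\<in>\<alpha>. U_representation X V (U V)"
    and sub: "subbase_of X (\<alpha> \<union> {topspace X - U V (2 * n - 1) | V n. V \<in> \<alpha> \<and> n \<ge> 1})"
    using \<alpha>(1)[unfolded almost_subbase_def] by (elim exE conjE) (rule that)
  obtain A where A: "ordered_as P r A \<alpha>" "\<forall>p\<in>P. point_finite X (A p)"
    using \<alpha>(2) unfolding P_property_def by blast
  have A_sub: "A p \<subseteq> \<alpha>" if "p \<in> P" for p using A(1) that unfolding ordered_as_def by blast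
  have A_mono: "A p \<subseteq> A q" if "p \<in> P" "q \<in> P" "(p, q) \<in> r" for p q
    using A(1) that unfolding ordered_as_def by meson
  have UV: "closedin X (U V (2 * n - 1))" "U V (2 * n - 1) \<subseteq> V" if "V \<in> \<alpha>" "n \<ge> 1" for V n
  proof -
    have rep: "U_representation X V (U V)" using U that(1) by blast
    then show "closedin X (U V (2 * n - 1))"
      using that(2) zero_set_imp_closedin[of X "U V (2 * n - 1)"]
      unfolding U_representation_def by blast
    show "U V (2 * n - 1) \<subseteq> V" using that(2) by (intro U_representation_subset[OF rep]) simp
  qed
  define C where "C m p = (\<lambda>V. topspace X - U V (2 * m - 1)) ` A p" for m p
  define S where "S n p = A p \<union> (\<Union>m\<in>{1..n}. C m p)" for n p
  have S_mono: "S m p \<subseteq> S n q" if "m \<le> n" "p \<in> P" "q \<in> P" "(p, q) \<in> r" for m n p q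
  proof -
    have "C k p \<subseteq> C k q" for k unfolding C_def using A_mono[OF that(2-4)] by blast
    moreover have "{1..m} \<subseteq> {1..n}" using that(1) by simp
    ultimately show ?thesis unfolding S_def using A_mono[OF that(2-4)] by blast
  qed
  have S_union: "\<alpha> \<union> {topspace X - U V (2 * n - 1) | V n. V \<in> \<alpha> \<and> n \<ge> 1} = (\<Union>n. \<Union>p\<in>P. S n p)"
  proof (intro subset_antisym subsetI)
    have \<alpha>_eq: "\<alpha> = (\<Union>p\<in>P. A p)" using A(1) unfolding ordered_as_def by blast
    fix G
    {
      assume "G \<in> \<alpha> \<union> {topspace X - U V (2 * n - 1) | V n. V \<in> \<alpha> \<and> n \<ge> 1}"
      then consider "G \<in> \<alpha>" | V n where "V \<in> \<alpha>" "n \<ge> 1" "G = topspace X - U V (2 * n - 1)" by blast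
      then show "G \<in> (\<Union>n. \<Union>p\<in>P. S n p)"
      proof cases
        case 1
        then show ?thesis unfolding S_def \<alpha>_eq by blast
      next
        case 2
        then obtain p where p: "p \<in> P" "V \<in> A p" unfolding \<alpha>_eq by blast
        then have "G \<in> C n p" unfolding C_def 2(3) by blast
        then have "G \<in> S n p" unfolding S_def using 2(2) by auto
        then show ?thesis using p(1) by blast
      qed
    next
      assume "G \<in> (\<Union>n. \<Union>p\<in>P. S n p)"
      then obtain n p where p: "p \<in> P" "G \<in> S n p" by blast
      then show "G \<in> \<alpha> \<union> {topspace X - U V (2 * n - 1) | V n. V \<in> \<alpha> \<and> n \<ge> 1}"
        using A_sub[OF p(1)] unfolding S_def C_def by fastforce
    }
  qed
  have S_open: "openin X G" if p: "p \<in> P" and G: "G \<in> S n p" for G n p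
  proof -
    have cases: "G \<in> A p \<or> (\<exists>V m. V \<in> A p \<and> m \<ge> 1 \<and> G = topspace X - U V (2 * m - 1))"
    proof (cases "G \<in> A p")
      case False
      then obtain m where m: "m \<in> {1..n}" "G \<in> C m p" using G unfolding S_def by blast
      then obtain V where "V \<in> A p" "G = topspace X - U V (2 * m - 1)" unfolding C_def by blast
      moreover have "m \<ge> 1" using m(1) by simp
      ultimately show ?thesis by blast
    qed simp
    have "openin X V" if "V \<in> A p" for V
      using that A_sub[OF p] U U_representation_openin by blast
    moreover have "openin X (topspace X - U V (2 * m - 1))" if "V \<in> A p" "m \<ge> 1" for V m
      using UV(1)[of V m] that A_sub[OF p] by (intro openin_diff openin_topspace) blast
    ultimately show ?thesis using cases by blast
  qed
  have S_pan: "point_additively_Noetherian X (S n p)" if p: "p \<in> P" for n p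
    unfolding point_additively_Noetherian_def
  proof
    fix x assume x: "x \<in> topspace X"
    have "finite {V \<in> A p. x \<in> V}" using A(2) p x unfolding point_finite_def by blast
    then have fin: "additively_Noetherian {V \<in> A p. x \<in> V}" by (rule finite_imp_additively_Noetherian)
    have "additively_Noetherian (C m p)" if "m \<in> {1..n}" for m
      unfolding C_def
    proof (rule additively_Noetherian_complements_of_zero_sets[OF comp])
      show "point_finite X (A p)" using A(2) p by blast
      show "closedin X (U V (2 * m - 1))" "U V (2 * m - 1) \<subseteq> V" if "V \<in> A p" for V
        using UV[of V m] that \<open>m \<in> {1..n}\<close> A_sub[OF p] by auto
    qed
    then have "additively_Noetherian (\<Union>m\<in>{1..n}. C m p)"
      by (intro additively_Noetherian_finite_UN) simp_all
    with fin have "additively_Noetherian ({V \<in> A p. x \<in> V} \<union> (\<Union>m\<in>{1..n}. C m p))"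
      by (rule additively_Noetherian_Un)
    then show "additively_Noetherian {G \<in> S n p. x \<in> G}"
      by (rule additively_Noetherian_subset) (auto simp: S_def)
  qed
  define B where "B n p = bounded_meets X (S n p) n" for n p
  have B_mono: "B m p \<subseteq> B n q" if "m \<le> n" "p \<in> P" "q \<in> P" "(p, q) \<in> r" for m n p q
    unfolding B_def using S_mono[OF that] that(1) by (rule bounded_meets_mono)
  have "P_property P r (point_additively_Noetherian X) (\<Union>n. \<Union>p\<in>P. B n p)"
  proof (rule P_property_of_double_index[OF dir ncd B_mono])
    show "point_additively_Noetherian X (B n p)" if "p \<in> P" for n p
      unfolding B_def by (rule bounded_meets_point_additively_Noetherian[OF S_pan[OF that]])
  qed
  moreover have "base_of X (\<Union>n. \<Union>p\<in>P. B n p)"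
    unfolding base_of_def openin_topology_base_unique
  proof (intro conjI allI impI)
    show "openin X G" if "G \<in> (\<Union>n. \<Union>p\<in>P. B n p)" for G
      using that bounded_meets_openin[of _ X] S_open unfolding B_def by blast
    fix G x assume "openin X G \<and> x \<in> G"
    then obtain \<T> where T: "finite \<T>" "\<T> \<subseteq> (\<Union>n. \<Union>p\<in>P. S n p)"
      "x \<in> topspace X \<inter> \<Inter>\<T>" "topspace X \<inter> \<Inter>\<T> \<subseteq> G"
      using subbase_of_neighbourhood[OF sub, of G x] unfolding S_union by metis
    obtain p0 where "p0 \<in> P" using dir unfolding directed_set_def by blast
    then obtain n p where np: "card \<T> \<le> n" "p \<in> P" "\<T> \<subseteq> S n p"
      using finite_subset_of_double_index[OF dir S_mono T(1,2), of p0 "card \<T>"] by blast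
    have "topspace X \<inter> \<Inter>\<T> \<in> B n p"
      unfolding B_def
      using bounded_meets_Inter[OF T(1) np(3)] bounded_meets_mono[OF subset_refl np(1)] by blast
    then show "\<exists>V. V \<in> (\<Union>n. \<Union>p\<in>P. B n p) \<and> x \<in> V \<and> V \<subseteq> G"
      using T(3,4) np(2) by blast
  qed
  ultimately show ?thesis by blast
qed

lemma base_imp_expandable_network:
  assumes "base_of X \<B>" "P_property P r (point_additively_Noetherian X) \<B>"
  shows "\<exists>\<N>. expandable_network X \<N> \<and> P_property P r (point_additively_Noetherian_pairs X) \<N>"
proof -
  obtain B where B: "ordered_as P r B \<B>" "\<forall>p\<in>P. point_additively_Noetherian X (B p)"
    using assms(2) unfolding P_property_def by blast
  let ?d = "\<lambda>V :: 'a set. (V, V)"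
  have opn: "openin X V" if "V \<in> \<B>" for V
    using assms(1) that unfolding base_of_def openin_topology_base_unique by blast
  have nhd: "\<exists>V\<in>\<B>. x \<in> V \<and> V \<subseteq> U" if "openin X U" "x \<in> U" for x U
    using assms(1) that unfolding base_of_def openin_topology_base_unique by meson
  have "expandable_network X (?d ` \<B>)"
    unfolding expandable_network_def
  proof (intro conjI allI impI)
    show "\<forall>(N, V)\<in>?d ` \<B>. N \<subseteq> V \<and> openin X V" using opn by auto
    fix x U assume "openin X U \<and> x \<in> U"
    then obtain V where "V \<in> \<B>" "x \<in> V" "V \<subseteq> U" using nhd by blast
    then show "\<exists>(N, V)\<in>?d ` \<B>. x \<in> N \<and> N \<subseteq> U"
      by (intro bexI[of _ "(V, V)"]) auto
  qed
  moreover have "ordered_as P r (\<lambda>p. ?d ` B p) (?d ` \<B>)"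
    using B(1) unfolding ordered_as_def by blast
  moreover have "point_additively_Noetherian_pairs X (?d ` B p)" if "p \<in> P" for p
  proof -
    have "fst ` {(N, V). (N, V) \<in> ?d ` B p \<and> x \<in> V} = {V \<in> B p. x \<in> V}" for x
      by (auto simp: image_iff)
    then show ?thesis
      using B(2) that
      unfolding point_additively_Noetherian_pairs_def point_additively_Noetherian_def by simp
  qed
  ultimately show ?thesis unfolding P_property_def by blast
qed

text \<open>The pair \<open>(N, V)\<close> contributes \<open>N \<union> {y}\<close> at every \<open>y \<in> V\<close>. If \<open>x \<in> N \<subseteq> U\<close>, the open set \<open>V \<inter> U\<close> is as
required, since it contains both \<open>N\<close> and \<open>y\<close>.\<close>

lemma expandable_network_imp_strong_point_network:
  assumes net: "expandable_network X \<N>"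
    and pan: "P_property P r (point_additively_Noetherian_pairs X) \<N>"
  shows "\<exists>W. P_strong_point_network P r additively_Noetherian X W"
proof -
  obtain M where M: "ordered_as P r M \<N>" "\<forall>p\<in>P. point_additively_Noetherian_pairs X (M p)"
    using pan unfolding P_property_def by blast
  have M_sub: "M p \<subseteq> \<N>" if "p \<in> P" for p using M(1) that unfolding ordered_as_def by blast
  have pair: "N \<subseteq> V" "openin X V" if "(N, V) \<in> \<N>" for N V
    using net that unfolding expandable_network_def by blast+
  define W where "W p y = insert y ` fst ` {(N, V). (N, V) \<in> M p \<and> y \<in> V}" for p y
  have W_I: "insert y N \<in> W p y" if "(N, V) \<in> M p" "y \<in> V" for p y N V
  proof -
    have "(N, V) \<in> {(N, V). (N, V) \<in> M p \<and> y \<in> V}" using that by simp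
    then have "fst (N, V) \<in> fst ` {(N, V). (N, V) \<in> M p \<and> y \<in> V}" by (rule imageI)
    then show ?thesis unfolding W_def by simp
  qed
  have W_E: "\<exists>N V. (N, V) \<in> M p \<and> y \<in> V \<and> A = insert y N" if A: "A \<in> W p y" for p y A
  proof -
    obtain e where e: "e \<in> {(N, V). (N, V) \<in> M p \<and> y \<in> V}" "A = insert y (fst e)"
      using A unfolding W_def by blast
    obtain N V where "e = (N, V)" by (cases e)
    with e have "(N, V) \<in> M p \<and> y \<in> V \<and> A = insert y N" by simp
    then show ?thesis by blast
  qed
  have "P_pointed_family P r additively_Noetherian X W"
    unfolding P_pointed_family_def
  proof (intro ballI conjI impI)
    fix y assume y: "y \<in> topspace X"
    show "additively_Noetherian (W p y)" if "p \<in> P" for p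
      unfolding W_def using M(2) that y unfolding point_additively_Noetherian_pairs_def
      by (intro additively_Noetherian_insert_point) blast
    show "A \<subseteq> topspace X" "y \<in> A" if p: "p \<in> P" and A: "A \<in> W p y" for p A
    proof -
      obtain N V where NV: "(N, V) \<in> M p" "A = insert y N" using W_E[OF A] by blast
      then have "N \<subseteq> V" "openin X V" using pair M_sub[OF p] by blast+
      then show "A \<subseteq> topspace X" "y \<in> A" using NV(2) y openin_subset by blast+
    qed
    show "W p y \<subseteq> W q y" if "p \<in> P" "q \<in> P" "(p, q) \<in> r" for p q
    proof -
      have "M p \<subseteq> M q" using M(1) that unfolding ordered_as_def by meson
      then show ?thesis unfolding W_def by (intro image_mono) blast
    qed
  qed
  moreover have "\<exists>V p. openin X V \<and> x \<in> V \<and> V \<subseteq> U \<and> p \<in> P \<and> (\<forall>y\<in>V. \<exists>A\<in>W p y. x \<in> A \<and> A \<subseteq> V)"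
    if U: "openin X U" "x \<in> U" for x U
  proof -
    obtain N V where NV: "(N, V) \<in> \<N>" "x \<in> N" "N \<subseteq> U"
      using net U unfolding expandable_network_def by blast
    then obtain p where p: "p \<in> P" "(N, V) \<in> M p" using M(1) unfolding ordered_as_def by blast
    show ?thesis
    proof (intro exI[of _ "V \<inter> U"] exI[of _ p] conjI ballI)
      show "openin X (V \<inter> U)" using pair(2)[OF NV(1)] U(1) by blast
      show "x \<in> V \<inter> U" using pair(1)[OF NV(1)] NV(2) U(2) by blast
      fix y assume "y \<in> V \<inter> U"
      then show "\<exists>A\<in>W p y. x \<in> A \<and> A \<subseteq> V \<inter> U"
        using W_I[OF p(2), of y] pair(1)[OF NV(1)] NV(2,3) by (intro bexI[of _ "insert y N"]) auto
    qed (use p(1) in auto)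
  qed
  ultimately show ?thesis unfolding P_strong_point_network_def by blast
qed

lemma strong_point_network_imp_point_network:
  assumes "P_strong_point_network P r Q X W"
  shows "P_point_network P r Q X W"
  using assms unfolding P_strong_point_network_def P_point_network_def by (meson order_trans)

section \<open>The equivalence\<close>

theorem theorem18:
  fixes X :: "'a topology" and P :: "'p set" and r :: "'p rel"
  assumes "tychonoff_space X" and "compact_space X"
    and "directed_set P r" and "\<not> countably_directed P r"
  shows
    "(embeds_in_Cp_of_filter_space TYPE('a set \<times> nat) P r X \<longleftrightarrow>
        (\<exists>\<alpha>. almost_subbase X \<alpha> \<and> P_property P r (point_finite X) \<alpha>)) \<and>
     ((\<exists>\<alpha>. almost_subbase X \<alpha> \<and> P_property P r (point_finite X) \<alpha>) \<longleftrightarrow>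
        (\<exists>\<B>. base_of X \<B> \<and> P_property P r (point_additively_Noetherian X) \<B>)) \<and>
     ((\<exists>\<B>. base_of X \<B> \<and> P_property P r (point_additively_Noetherian X) \<B>) \<longleftrightarrow>
        (\<exists>\<N>. expandable_network X \<N> \<and> P_property P r (point_additively_Noetherian_pairs X) \<N>)) \<and>
     ((\<exists>\<N>. expandable_network X \<N> \<and> P_property P r (point_additively_Noetherian_pairs X) \<N>) \<longleftrightarrow>
        (\<exists>W. P_strong_point_network P r additively_Noetherian X W)) \<and>
     ((\<exists>W. P_strong_point_network P r additively_Noetherian X W) \<longleftrightarrow>
        (\<exists>W. P_point_network P r additively_Noetherian X W)) \<and>
     (embeds_in_Cp_of_filter_space TYPE('s) P r X \<longrightarrow>
        embeds_in_Cp_of_filter_space TYPE('a set \<times> nat) P r X)"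
    (is "(?embeds \<longleftrightarrow> ?almost_subbase) \<and> (_ \<longleftrightarrow> ?base) \<and> (_ \<longleftrightarrow> ?expandable) \<and>
      (_ \<longleftrightarrow> ?strong) \<and> (_ \<longleftrightarrow> ?weak) \<and> (?embeds' \<longrightarrow> _)")
proof -
  have haus: "Hausdorff_space X" using assms(1) unfolding tychonoff_space_def by blast
  note dir = assms(3) and ncd = assms(4) and comp = assms(2)
  have "?embeds \<Longrightarrow> ?almost_subbase" "?embeds' \<Longrightarrow> ?almost_subbase"
    by (rule embeds_in_Cp_imp_almost_subbase[OF dir ncd comp haus], assumption)+
  moreover have "?almost_subbase \<Longrightarrow> ?embeds"
    using almost_subbase_imp_embeds_in_Cp[OF dir ncd comp haus] by (elim exE conjE)
  moreover have "?almost_subbase \<Longrightarrow> ?base"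
    using almost_subbase_imp_base[OF dir ncd comp] by (elim exE conjE)
  moreover have "?base \<Longrightarrow> ?expandable"
    using base_imp_expandable_network by (elim exE conjE)
  moreover have "?expandable \<Longrightarrow> ?strong"
    using expandable_network_imp_strong_point_network by (elim exE conjE)
  moreover have "?strong \<Longrightarrow> ?weak"
    by (meson strong_point_network_imp_point_network)
  moreover have "?weak \<Longrightarrow> ?almost_subbase"
    using point_network_imp_almost_subbase[OF dir ncd comp haus] by (elim exE)
  ultimately show ?thesis by argo
qed

end
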